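(* Let $d\ge2$ and let $\Omega\subset\mathbb{R}^d$ be a bounded open set with $\partial\Omega\in C^{1,1}$. Let $E\subset\Omega$ be one of its Cheeger sets. Then $$\mathcal{H}^{d-1}(\partial E\cap\partial\Omega)>0 .$$ The same conclusion is valid if $\Omega\subset\mathbb{R}^d$ is a bounded open convex set (with no further regularity assumption on $\partial\Omega$).
   Context: $P(E)$ is the distributional perimeter of $E$ in $\mathbb{R}^d$, $\mathcal{L}^d$ is Lebesgue measure, $\mathcal{H}^{d-1}$ is the $(d-1)$-dimensional Hausdorff measure. Cheeger sets: for $\Omega\subset\mathbb{R}^d$ open and bounded, $h(\Omega):=\inf\{P(E)/\mathcal{L}^d(E)\}$, the infimum being over sets of finite perimeter $E\subset\Omega$ (with $\mathcal{L}^d(E)>0$). A set $E\subset\Omega$ of finite perimeter attaining the infimum is a Cheeger set of $\Omega$. As usual, sets of finite perimeter are normalized modulo Lebesgue-null sets so that the topological boundary is $\partial E=\{x: 0<\mathcal{L}^d(E\cap B_r(x))<\mathcal{L}^d(B_r(x))\ \forall r>0\}$. $\partial\Omega\in C^{1,1}$ means: near each boundary point, in a suitable orthonormal frame, $\partial\Omega$ is the graph of a $C^{1,1}$ function and $\Omega$ is locally the region below the graph. *)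

theory Defs
  imports "HOL-Analysis.Analysis"
begin

definition divergence :: "('a::euclidean_space \<Rightarrow> 'a) \<Rightarrow> 'a \<Rightarrow> real" where
  "divergence \<phi> x = (\<Sum>b\<in>Basis. frechet_derivative \<phi> (at x) b \<bullet> b)"

text \<open>The space \<open>C\<^sub>c\<^sup>1(\<real>\<^sup>d; \<real>\<^sup>d)\<close>. In finite dimension, continuity of every directional derivative
  is the same as continuity of the derivative.\<close>

definition C1_compact_support :: "('a::euclidean_space \<Rightarrow> 'a) \<Rightarrow> bool" where
  "C1_compact_support \<phi> \<longleftrightarrow>
     (\<forall>x. \<phi> differentiable (at x)) \<and>
     (\<forall>v. continuous_on UNIV (\<lambda>x. frechet_derivative \<phi> (at x) v)) \<and>
     compact (closure {x. \<phi> x \<noteq> 0})"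

text \<open>Since \<open>\<phi> = 0\<close> is admissible, the supremum over the reals is nonnegative, so
  the truncation of negative integrals by \<open>ennreal\<close> does not change it.\<close>

definition perimeter :: "'a::euclidean_space set \<Rightarrow> ennreal" where
  "perimeter E =
     (SUP \<phi>\<in>{\<phi>. C1_compact_support \<phi> \<and> (\<forall>x. norm (\<phi> x) \<le> 1)}.
        ennreal (LINT x:E|lebesgue. divergence \<phi> x))"

definition finite_perimeter :: "'a::euclidean_space set \<Rightarrow> bool" where
  "finite_perimeter E \<longleftrightarrow> E \<in> sets lebesgue \<and> perimeter E < \<infinity>"

definition cheeger_constant :: "'a::euclidean_space set \<Rightarrow> ennreal" where
  "cheeger_constant \<Omega> =
     (INF E\<in>{E. E \<subseteq> \<Omega> \<and> finite_perimeter E \<and> 0 < emeasure lebesgue E}.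
        perimeter E / emeasure lebesgue E)"

definition cheeger_set :: "'a::euclidean_space set \<Rightarrow> 'a set \<Rightarrow> bool" where
  "cheeger_set \<Omega> E \<longleftrightarrow>
     E \<subseteq> \<Omega> \<and> finite_perimeter E \<and> 0 < emeasure lebesgue E \<and>
     perimeter E / emeasure lebesgue E = cheeger_constant \<Omega>"

text \<open>The boundary of a set of finite perimeter, in the convention where such sets are normalized
  modulo null sets: it depends only on the Lebesgue class of \<open>E\<close>, is contained in
  \<open>frontier E\<close> for every representative, and equals it for a normalized one.\<close>

definition normalized_boundary :: "'a::euclidean_space set \<Rightarrow> 'a set" where
  "normalized_boundary E =
     {x. \<forall>r>0. 0 < emeasure lebesgue (E \<inter> ball x r) \<and>
               emeasure lebesgue (E \<inter> ball x r) < emeasure lebesgue (ball x r)}"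

text \<open>The \<open>m\<close>-dimensional Hausdorff (outer) measure, normalized to agree with Lebesgue measure
  on \<open>\<real>\<^sup>m\<close>. Covering sets have to be bounded because \<open>diameter\<close> is meaningless otherwise;
  the empty set is treated separately only for the sake of \<open>m = 0\<close>.\<close>

definition hausdorff_content :: "nat \<Rightarrow> real \<Rightarrow> 'a::metric_space set \<Rightarrow> ennreal" where
  "hausdorff_content m \<delta> A =
     (INF U\<in>{U :: nat \<Rightarrow> 'a set. A \<subseteq> (\<Union>i. U i) \<and> (\<forall>i. bounded (U i) \<and> diameter (U i) \<le> \<delta>)}.
        \<Sum>i. if U i = {} then 0
             else ennreal (unit_ball_vol (real m) * (diameter (U i) / 2) ^ m))"

definition hausdorff_measure :: "nat \<Rightarrow> 'a::metric_space set \<Rightarrow> ennreal" where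
  "hausdorff_measure m A = (SUP \<delta>\<in>{0<..}. hausdorff_content m \<delta> A)"

text \<open>\<open>D\<close> is meant to be a relatively open subset of a subspace. The derivative is taken within
  \<open>D\<close>, so only the component of the gradient \<open>G y\<close> tangent to that subspace matters.\<close>

definition C11_on :: "'a::euclidean_space set \<Rightarrow> ('a \<Rightarrow> real) \<Rightarrow> bool" where
  "C11_on D \<gamma> \<longleftrightarrow>
     (\<exists>G L. (\<forall>y\<in>D. (\<gamma> has_derivative (\<lambda>v. G y \<bullet> v)) (at y within D)) \<and> L-lipschitz_on D G)"

text \<open>The orthonormal frame is centred at \<open>p\<close> and has the unit vector \<open>\<nu>\<close> as its last vector;
  the span of the other vectors is the hyperplane orthogonal to \<open>\<nu>\<close>, on which the graph function
  \<open>\<gamma>\<close> lives. A point near \<open>p\<close> is written \<open>p + y + t *\<^sub>R \<nu>\<close> with \<open>y\<close> in this hyperplane.\<close>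

definition C11_boundary :: "'a::euclidean_space set \<Rightarrow> bool" where
  "C11_boundary \<Omega> \<longleftrightarrow>
     (\<forall>p\<in>frontier \<Omega>. \<exists>\<nu> r h \<gamma>.
        norm \<nu> = 1 \<and> 0 < r \<and> 0 < h \<and>
        C11_on {y. y \<bullet> \<nu> = 0 \<and> norm y < r} \<gamma> \<and>
        (\<forall>y t. y \<bullet> \<nu> = 0 \<and> norm y < r \<and> \<bar>t\<bar> < h \<longrightarrow>
           (p + y + t *\<^sub>R \<nu> \<in> \<Omega> \<longleftrightarrow> t < \<gamma> y) \<and>
           (p + y + t *\<^sub>R \<nu> \<in> frontier \<Omega> \<longleftrightarrow> t = \<gamma> y)))"

end

theory Submission
  imports Defs
begin

text \<open>
  In both cases there is \<open>R > 0\<close> such that the points outside of \<open>closure \<Omega>\<close> close to it are covered by balls of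
  radius at least \<open>R\<close> disjoint from \<open>\<Omega>\<close>, and \<open>\<Omega>\<close> has exterior cones. Removing an exterior ball \<open>B\<close> from a set \<open>F\<close> increases the perimeter by at most
  \<open>(d / R) |F \<inter> B|\<close>; removing countably many gives \<open>P (F \<inter> \<Omega>) \<le> P F + (d / R) |F - \<Omega>|\<close> for \<open>F\<close> near \<open>\<Omega>\<close>.
  Apply this to a dilation \<open>F = t E\<close> of the Cheeger set, \<open>t > 1\<close>: by scaling, \<open>P - h |\<cdot>|\<close> drops by about
  \<open>(t - 1) P E\<close>, and as \<open>t E \<inter> \<Omega>\<close> is a competitor, \<open>|t E - \<Omega>| \<ge> k (t - 1)\<close> with \<open>k > 0\<close> independent of \<open>t\<close>.
  If the contact set were \<open>H\<^sup>d\<^sup>-\<^sup>1\<close>-null, it could be covered by finitely many balls of radii \<open>r\<^sub>i\<close> with \<open>\<Sum> r\<^sub>i\<^sup>d\<^sup>-\<^sup>1\<close>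
  small. Outside of them \<open>E\<close> stays away from \<open>\<partial>\<Omega>\<close>, and the exterior cones bound the volume that leaves \<open>\<Omega>\<close> in the
  \<open>i\<close>-th ball by \<open>C r\<^sub>i\<^sup>d\<^sup>-\<^sup>1 (t - 1)\<close>: a contradiction.
\<close>

subsection \<open>Perimeter and scaling\<close>

text \<open>For nonnegative \<open>p\<close> the truncation by \<open>ennreal\<close> is harmless,
  so bounds on the perimeter become real inequalities, one for each test field.\<close>

lemma perimeter_le_iff:
  assumes "0 \<le> p"
  shows "perimeter E \<le> ennreal p \<longleftrightarrow>
    (\<forall>\<phi>. C1_compact_support \<phi> \<longrightarrow> (\<forall>x. norm (\<phi> x) \<le> 1) \<longrightarrow>
      (LINT x:E|lebesgue. divergence \<phi> x) \<le> p)"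
  using assms by (auto simp: perimeter_def SUP_le_iff ennreal_le_iff)

lemma divergence_eq:
  assumes "(\<phi> has_derivative D) (at x)"
  shows "divergence \<phi> x = (\<Sum>b\<in>Basis. D b \<bullet> b)"
  unfolding divergence_def using frechet_derivative_at[OF assms] by simp

lemma C1_compact_supportI:
  fixes \<phi> :: "'a::euclidean_space \<Rightarrow> 'a"
  assumes D: "\<And>x. (\<phi> has_derivative D x) (at x)"
    and "\<And>v. continuous_on UNIV (\<lambda>x. D x v)"
    and "bounded S" "\<And>x. x \<notin> S \<Longrightarrow> \<phi> x = 0"
  shows "C1_compact_support \<phi>"
proof -
  have "frechet_derivative \<phi> (at x) = D x" for x
    using frechet_derivative_at[OF D] by simp
  moreover have "\<phi> differentiable (at x)" for x
    using D differentiable_def by blast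
  moreover have "bounded {x. \<phi> x \<noteq> 0}"
    using assms(3) by (rule bounded_subset) (use assms(4) in blast)
  ultimately show ?thesis
    unfolding C1_compact_support_def using assms(2) by (simp add: compact_closure)
qed

lemma C1_compact_support_has_derivative:
  assumes "C1_compact_support \<phi>"
  shows "(\<phi> has_derivative frechet_derivative \<phi> (at x)) (at x)"
  using assms frechet_derivative_works unfolding C1_compact_support_def by blast

lemma continuous_on_divergence:
  assumes "C1_compact_support \<phi>"
  shows "continuous_on UNIV (divergence \<phi>)"
  using assms unfolding C1_compact_support_def divergence_def
  by (auto intro!: continuous_intros)

text \<open>Continuity bounds the divergence on the compact closure of the support. Off that closure
  the field vanishes on an open set, and so does its divergence.\<close>

lemma divergence_bounded:
  fixes \<phi> :: "'a::euclidean_space \<Rightarrow> 'a"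
  assumes "C1_compact_support \<phi>"
  obtains B where "0 \<le> B" "\<And>x. \<bar>divergence \<phi> x\<bar> \<le> B"
proof -
  let ?K = "closure {x. \<phi> x \<noteq> 0}"
  have K: "compact ?K" using assms by (simp add: C1_compact_support_def)
  have "compact (divergence \<phi> ` ?K)"
    using K continuous_on_divergence[OF assms] compact_continuous_image continuous_on_subset by blast
  then obtain B where B: "0 < B" "\<And>x. x \<in> ?K \<Longrightarrow> \<bar>divergence \<phi> x\<bar> \<le> B"
    by (metis bounded_pos compact_imp_bounded image_eqI real_norm_def)
  have "divergence \<phi> x = 0" if "x \<notin> ?K" for x
  proof -
    have "((\<lambda>x. 0) has_derivative (\<lambda>v. 0)) (at x)" by simp
    then have "(\<phi> has_derivative (\<lambda>v. 0)) (at x)"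
      by (rule has_derivative_transform_within_open[OF _ open_Compl[OF closed_closure]])
        (use that closure_subset[of "{x. \<phi> x \<noteq> 0}"] in auto)
    from divergence_eq[OF this] show ?thesis by simp
  qed
  then have "\<bar>divergence \<phi> x\<bar> \<le> B" for x using B by (cases "x \<in> ?K") auto
  with B(1) show ?thesis using that[of B] by simp
qed

lemma divergence_measurable:
  fixes \<phi> :: "'a::euclidean_space \<Rightarrow> 'a"
  assumes "C1_compact_support \<phi>"
  shows "divergence \<phi> \<in> borel_measurable lebesgue"
proof -
  have "divergence \<phi> \<in> borel_measurable borel"
    using continuous_on_divergence[OF assms] by (rule borel_measurable_continuous_onI)
  then show ?thesis by (simp add: measurable_completion)
qed

lemma set_integrable_bounded:
  fixes f :: "'a::euclidean_space \<Rightarrow> real"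
  assumes F: "F \<in> lmeasurable" and f: "f \<in> borel_measurable lebesgue"
    and B: "\<And>x. \<bar>f x\<bar> \<le> B"
  shows "set_integrable lebesgue F f"
  unfolding set_integrable_def
proof (rule Bochner_Integration.integrable_bound[where f = "\<lambda>x. B * indicator F x"])
  show "integrable lebesgue (\<lambda>x. B * indicator F x :: real)"
    using F by (intro integrable_mult_right) (auto simp: integrable_indicator_iff fmeasurable_def)
  show "(\<lambda>x. indicator F x *\<^sub>R f x) \<in> borel_measurable lebesgue"
    using F f by (auto simp: fmeasurable_def)
  have "0 \<le> B" using B[of undefined] by linarith
  then show "AE x in lebesgue. norm (indicator F x *\<^sub>R f x) \<le> norm (B * indicator F x :: real)"
    using B by (intro AE_I2) (auto simp: indicator_def intro: order_trans)
qed

lemma set_integrable_divergence: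
  fixes \<phi> :: "'a::euclidean_space \<Rightarrow> 'a"
  assumes "C1_compact_support \<phi>" "F \<in> lmeasurable"
  shows "set_integrable lebesgue F (divergence \<phi>)"
  using divergence_bounded[OF assms(1)] divergence_measurable[OF assms(1)] set_integrable_bounded assms(2)
  by metis

text \<open>For a fixed test field the integral over \<open>A n\<close> converges by dominated
  convergence, with the divergence on \<open>F\<close> as majorant. A bound uniform in
  \<open>n\<close> passes to the limit, field by field.\<close>

lemma perimeter_lower_semicontinuous:
  fixes F :: "'a::euclidean_space set"
  assumes F: "F \<in> lmeasurable" and A: "\<And>n. A n \<in> sets lebesgue" "\<And>n. A n \<subseteq> F"
    and G: "G \<in> sets lebesgue"
    and lim: "AE x in lebesgue. (\<lambda>n. indicator (A n) x :: real) \<longlonglongrightarrow> indicator G x"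
    and p: "\<And>n. perimeter (A n) \<le> ennreal p" "0 \<le> p"
  shows "perimeter G \<le> ennreal p"
  unfolding perimeter_le_iff[OF p(2)]
proof (intro allI impI)
  fix \<phi> :: "'a \<Rightarrow> 'a"
  assume \<phi>: "C1_compact_support \<phi>" "\<forall>x. norm (\<phi> x) \<le> 1"
  have *: "(LINT x:A n|lebesgue. divergence \<phi> x) \<le> p" for n
    using p(1)[of n] \<phi> unfolding perimeter_le_iff[OF p(2)] by blast
  have "(\<lambda>n. LINT x|lebesgue. indicator (A n) x *\<^sub>R divergence \<phi> x)
     \<longlonglongrightarrow> (LINT x|lebesgue. indicator G x *\<^sub>R divergence \<phi> x)"
  proof (rule integral_dominated_convergence[where w = "\<lambda>x. norm (indicator F x *\<^sub>R divergence \<phi> x)"])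
    show "integrable lebesgue (\<lambda>x. norm (indicator F x *\<^sub>R divergence \<phi> x))"
      using set_integrable_divergence[OF \<phi>(1) F] unfolding set_integrable_def by (rule integrable_norm)
    show "AE x in lebesgue. (\<lambda>n. indicator (A n) x *\<^sub>R divergence \<phi> x) \<longlonglongrightarrow> indicator G x *\<^sub>R divergence \<phi> x"
      using lim by eventually_elim (intro tendsto_intros)
    show "AE x in lebesgue. norm (indicator (A n) x *\<^sub>R divergence \<phi> x)
        \<le> norm (indicator F x *\<^sub>R divergence \<phi> x)" for n
      using A(2) by (intro AE_I2) (auto simp: indicator_def)
  qed (use A G divergence_measurable[OF \<phi>(1)] in auto)
  then show "(LINT x:G|lebesgue. divergence \<phi> x) \<le> p"
    unfolding set_lebesgue_integral_def[symmetric]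
    by (rule LIMSEQ_le_const2) (use * in blast)
qed

lemma sets_lebesgue_scaleR:
  fixes S :: "'a::euclidean_space set"
  assumes "S \<in> sets lebesgue"
  shows "(*\<^sub>R) t ` S \<in> sets lebesgue"
  using assms by (intro differentiable_image_in_sets_lebesgue) (auto intro!: derivative_intros)

lemma lmeasurable_scaleR:
  fixes S :: "'a::euclidean_space set"
  assumes "S \<in> lmeasurable"
  shows "(*\<^sub>R) t ` S \<in> lmeasurable"
proof (rule fmeasurableI)
  show "(*\<^sub>R) t ` S \<in> sets lebesgue"
    using fmeasurableD[OF assms] by (rule sets_lebesgue_scaleR)
  show "emeasure lebesgue ((*\<^sub>R) t ` S) < \<infinity>"
    using emeasure_lebesgue_affine[of t 0 S] fmeasurableD2[OF assms]
    by (simp add: ennreal_mult_less_top less_top del: emeasure_completion)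
qed

text \<open>A test field \<phi> on the dilated set is pulled back to
  \<open>\<phi> (t *\<^sub>R x)\<close>, which is again admissible. The change of variables
  contributes \<open>t ^ d\<close>, and the divergence of the pullback absorbs one factor
  \<open>t\<close>.\<close>

lemma perimeter_scaleR_le:
  fixes E :: "'a::euclidean_space set"
  assumes E: "E \<in> sets lebesgue" and p: "perimeter E \<le> ennreal p" "0 \<le> p" and t: "0 < t"
  shows "perimeter ((*\<^sub>R) t ` E) \<le> ennreal (t ^ (DIM('a) - 1) * p)"
proof -
  have "(LINT x:(*\<^sub>R) t ` E|lebesgue. divergence \<phi> x) \<le> t ^ (DIM('a) - 1) * p"
    if \<phi>: "C1_compact_support \<phi>" "\<forall>x. norm (\<phi> x) \<le> 1" for \<phi> :: "'a \<Rightarrow> 'a"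
  proof -
    define \<psi> where "\<psi> = (\<lambda>x. \<phi> (t *\<^sub>R x))"
    let ?D = "\<lambda>x. frechet_derivative \<phi> (at x)"
    have D: "(\<psi> has_derivative (\<lambda>v. ?D (t *\<^sub>R x) (t *\<^sub>R v))) (at x)" for x
      unfolding \<psi>_def
      by (rule has_derivative_compose[OF _ C1_compact_support_has_derivative[OF \<phi>(1)]])
        (auto intro!: derivative_eq_intros)
    have lin: "linear (?D x)" for x
      using C1_compact_support_has_derivative[OF \<phi>(1)] has_derivative_linear by blast
    have div: "divergence \<psi> x = t * divergence \<phi> (t *\<^sub>R x)" for x
      by (subst divergence_eq[OF D]) (simp add: divergence_def linear_cmul[OF lin] sum_distrib_left)
    have cont: "continuous_on UNIV (\<lambda>x. ?D (t *\<^sub>R x) (t *\<^sub>R v))" for v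
      by (rule continuous_on_compose2[of UNIV "\<lambda>x. ?D x (t *\<^sub>R v)"])
        (use \<phi>(1) in \<open>auto simp: C1_compact_support_def intro!: continuous_intros\<close>)
    have "bounded ((*\<^sub>R) (1/t) ` {x. \<phi> x \<noteq> 0})"
      using \<phi>(1) unfolding C1_compact_support_def
      by (intro bounded_scaling) (meson bounded_subset closure_subset compact_imp_bounded)
    then have \<psi>: "C1_compact_support \<psi>"
    proof (rule C1_compact_supportI[OF D cont])
      show "\<psi> x = 0" if "x \<notin> (*\<^sub>R) (1/t) ` {x. \<phi> x \<noteq> 0}" for x
        using that t unfolding \<psi>_def by (force simp: image_iff)
    qed
    have "(LINT x:E|lebesgue. divergence \<psi> x) \<le> p"
      using p(1) \<psi> \<phi>(2) unfolding perimeter_le_iff[OF p(2)] \<psi>_def by blast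
    then have 1: "(LINT x:E|lebesgue. divergence \<phi> (t *\<^sub>R x)) * t \<le> p"
      unfolding div by (simp add: set_integral_mult_right mult.commute)
    let ?g = "\<lambda>x. indicator ((*\<^sub>R) t ` E) x *\<^sub>R divergence \<phi> x"
    have tE: "(*\<^sub>R) t ` E \<in> sets lebesgue"
      using E by (rule sets_lebesgue_scaleR)
    have g: "?g \<in> borel_measurable lebesgue"
      using tE divergence_measurable[OF \<phi>(1)] by (intro borel_measurable_scaleR) auto
    have "(LINT x|lebesgue. ?g x) = t ^ DIM('a) * (LINT x|lebesgue. ?g (t *\<^sub>R x))"
    proof -
      \<comment> \<open>\<open>lebesgue_affine_euclidean\<close> scales each coordinate by its own
        factor. With all factors equal to \<open>t\<close>, the sum over the basis collapses to
        \<open>t *\<^sub>R x\<close> and the Jacobian to \<open>t ^ DIM('a)\<close>.\<close>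
      have "(LINT x|lebesgue. ?g x) = (LINT x|density (distr lebesgue lebesgue (\<lambda>x. t *\<^sub>R x)) (\<lambda>_. (\<bar>t\<bar>^DIM('a))). ?g x)"
        using t by (subst lebesgue_affine_euclidean[of "\<lambda>_. t" 0])
          (simp_all add: scaleR_scaleR[symmetric] scaleR_sum_right[symmetric] euclidean_representation prod_constant del: scaleR_scaleR)
      also have "\<dots> = t ^ DIM('a) * (LINT x|lebesgue. ?g (t *\<^sub>R x))"
        using t g by (subst integral_density; (subst integral_distr)?) auto
      finally show ?thesis .
    qed
    moreover have "(\<lambda>x. ?g (t *\<^sub>R x)) = (\<lambda>x. indicator E x *\<^sub>R divergence \<phi> (t *\<^sub>R x))"
      using t by (auto simp: indicator_def fun_eq_iff)
    ultimately have "(LINT x:(*\<^sub>R) t ` E|lebesgue. divergence \<phi> x)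
        = t ^ DIM('a) * (LINT x:E|lebesgue. divergence \<phi> (t *\<^sub>R x))"
      by (simp only: set_lebesgue_integral_def)
    also have "\<dots> = t ^ (DIM('a) - 1) * ((LINT x:E|lebesgue. divergence \<phi> (t *\<^sub>R x)) * t)"
      by (subst power_eq_if) (simp add: mult_ac)
    also have "\<dots> \<le> t ^ (DIM('a) - 1) * p"
      using 1 t by (intro mult_left_mono) auto
    finally show ?thesis .
  qed
  then show ?thesis using p(2) t by (subst perimeter_le_iff) auto
qed

subsection \<open>Removal of balls\<close>

text \<open>Squaring the positive part removes its kink at 0; the cutoffs built from it are
  therefore C^1, as test fields require.\<close>

lemma has_real_derivative_max_0_power2:
  "((\<lambda>s::real. (max 0 s)\<^sup>2) has_real_derivative 2 * max 0 s) (at s)"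
proof -
  consider "s > 0" | "s < 0" | "s = 0" by linarith
  then show ?thesis
  proof cases
    case 1
    have "((\<lambda>s::real. s\<^sup>2) has_real_derivative 2 * max 0 s) (at s)"
      using 1 by (auto intro!: derivative_eq_intros)
    then show ?thesis
      by (rule has_field_derivative_transform_within_open[of _ _ _ "{0<..}"]) (use 1 in auto)
  next
    case 2
    have "((\<lambda>s::real. 0) has_real_derivative 2 * max 0 s) (at s)"
      using 2 by auto
    then show ?thesis
      by (rule has_field_derivative_transform_within_open[of _ _ _ "{..<0}"]) (use 2 in auto)
  next
    case 3
    have "(\<lambda>h::real. (max 0 h)\<^sup>2 / h) \<midarrow>0\<rightarrow> 0"
    proof (rule Lim_null_comparison[where g = "\<lambda>h. \<bar>h\<bar>"])
      show "\<forall>\<^sub>F h::real in at 0. norm ((max 0 h)\<^sup>2 / h) \<le> \<bar>h\<bar>"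
        by (intro always_eventually allI) (auto simp: max_def power2_eq_square)
      show "((\<lambda>h::real. \<bar>h\<bar>) \<longlongrightarrow> 0) (at 0)"
        by (rule tendsto_eq_intros | simp)+
    qed
    then show ?thesis using 3 by (simp add: DERIV_def)
  qed
qed

text \<open>Chain rule. For positive \<open>R\<close> the gradient of the cutoff is a nonpositive
  multiple of \<open>w x\<close>; this sign is what makes the removal of a ball work.\<close>

lemma has_derivative_cutoff:
  fixes c x :: "'a::real_inner" and R :: real
  defines "w \<equiv> \<lambda>x. (1 / R) *\<^sub>R (x - c)"
  shows "((\<lambda>x. (max 0 (1 - w x \<bullet> w x))\<^sup>2) has_derivative
     (\<lambda>v. - (4 * max 0 (1 - w x \<bullet> w x) / R) * (w x \<bullet> v))) (at x)"
proof -
  have Dw: "(w has_derivative (\<lambda>v. (1 / R) *\<^sub>R v)) (at x)"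
    unfolding w_def by (auto intro!: derivative_eq_intros)
  have "((\<lambda>x. 1 - w x \<bullet> w x) has_derivative (\<lambda>v. - (2 / R) * (w x \<bullet> v))) (at x)"
    by (rule derivative_eq_intros Dw refl)+ (simp add: inner_commute fun_eq_iff)
  moreover have "((\<lambda>s. (max 0 s)\<^sup>2) has_derivative (\<lambda>h. 2 * max 0 (1 - w x \<bullet> w x) * h)) (at (1 - w x \<bullet> w x))"
    using has_real_derivative_max_0_power2[of "1 - w x \<bullet> w x"]
    by (simp only: has_field_derivative_def)
  ultimately have "((\<lambda>x. (max 0 (1 - w x \<bullet> w x))\<^sup>2) has_derivative
      (\<lambda>v. 2 * max 0 (1 - w x \<bullet> w x) * (- (2 / R) * (w x \<bullet> v)))) (at x)"
    by (rule has_derivative_compose)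
  then show ?thesis by (simp add: mult_ac)
qed

text \<open>Each of the \<open>Suc m\<close> terms of the geometric sum of
  \<open>(1 - v) ^ k\<close> is at least \<open>(1 - v) ^ m\<close>, and \<open>v\<close> times that
  sum telescopes to \<open>1 - (1 - v) ^ Suc m\<close>. This gives a bound on the error term uniform
  in \<open>m\<close>.\<close>

lemma Suc_mult_power_le_1:
  fixes v :: real
  assumes "0 \<le> v" "v \<le> 1"
  shows "real (Suc m) * v * (1 - v) ^ m \<le> 1"
proof -
  have "real (Suc m) * (1 - v) ^ m = (\<Sum>k<Suc m. (1 - v) ^ m)" by simp
  also have "\<dots> \<le> (\<Sum>k<Suc m. (1 - v) ^ k)"
    using assms by (intro sum_mono power_decreasing) auto
  finally have "real (Suc m) * (1 - v) ^ m * v \<le> v * (\<Sum>k<Suc m. (1 - v) ^ k)"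
    using assms by (metis mult.commute mult_left_mono)
  also have "\<dots> = 1 - (1 - v) ^ Suc m"
    using one_diff_power_eq[of "1 - v" "Suc m"] by simp
  also have "\<dots> \<le> 1" using assms by simp
  finally show ?thesis by (simp add: mult_ac)
qed

text \<open>The test fields interpolate between \<open>\<phi>\<close> outside the ball and \<open>- (x - c) / R\<close> inside it, whose divergence
  is \<open>- d / R\<close>, by means of the weight \<open>1 - (1 - V)\<^sup>n\<close> with \<open>V = (max 0 (1 - |x - c|\<^sup>2 / R\<^sup>2))\<^sup>2\<close>. On the sphere
  \<open>- (x - c) / R\<close> points in the direction of the gradient of the weight, so the gradient term is nonnegative
  up to an error \<open>(4 / R) n V (1 - V)\<^sup>n\<^sup>-\<^sup>1\<close>, which is bounded and tends to \<open>0\<close> pointwise.\<close>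

lemma perimeter_Diff_ball_le:
  fixes F :: "'a::euclidean_space set"
  assumes F: "F \<in> lmeasurable" and R: "0 < R" and p: "perimeter F \<le> ennreal p" "0 \<le> p"
  shows "perimeter (F - ball c R) \<le> ennreal (p + DIM('a) / R * measure lebesgue (F \<inter> ball c R))"
proof -
  have "(LINT x:F - ball c R|lebesgue. divergence \<phi> x)
      \<le> p + DIM('a) / R * measure lebesgue (F \<inter> ball c R)"
    if \<phi>: "C1_compact_support \<phi>" "\<forall>x. norm (\<phi> x) \<le> 1" for \<phi> :: "'a \<Rightarrow> 'a"
  proof -
    define w where "w = (\<lambda>x. (1 / R) *\<^sub>R (x - c))"
    define u where "u = (\<lambda>x. max 0 (1 - w x \<bullet> w x))"
    define V where "V = (\<lambda>x. (u x)\<^sup>2)"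
    \<comment> \<open>The exponent is \<open>Suc m\<close>, so that its derivative carries the power
      \<open>m\<close> without a truncated subtraction.\<close>
    define \<psi> where "\<psi> = (\<lambda>m x. (1 - V x) ^ Suc m *\<^sub>R \<phi> x - (1 - (1 - V x) ^ Suc m) *\<^sub>R w x)"
    let ?D = "\<lambda>x. frechet_derivative \<phi> (at x)"
    define V' where "V' = (\<lambda>x v. - (4 * u x / R) * (w x \<bullet> v))"
    \<comment> \<open>A lower bound for the divergence of \<open>\<psi> m\<close>, with the gradient
      term replaced by its worst value. It is bounded uniformly in \<open>m\<close> and converges
      pointwise, so dominated convergence applies to it.\<close>
    define g where "g = (\<lambda>m x. (1 - V x) ^ Suc m * divergence \<phi> x - (1 - (1 - V x) ^ Suc m) * (DIM('a) / R)
       - 4 / R * (real (Suc m) * V x * (1 - V x) ^ m))"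
    have w1: "norm (w x) < 1 \<longleftrightarrow> x \<in> ball c R" for x
      using R unfolding w_def norm_scaleR by (simp add: dist_norm norm_minus_commute)
    have u0: "u x > 0 \<longleftrightarrow> x \<in> ball c R" for x
    proof -
      have "u x > 0 \<longleftrightarrow> (norm (w x))\<^sup>2 < 1" by (simp add: u_def power2_norm_eq_inner less_max_iff_disj)
      also have "\<dots> \<longleftrightarrow> norm (w x) < 1" by (simp add: abs_square_less_1)
      finally show ?thesis using w1 by simp
    qed
    have u01: "0 \<le> u x" "u x \<le> 1" for x by (auto simp: u_def)
    have V01: "0 \<le> V x" "V x \<le> 1" for x using u01 by (auto simp: V_def power_le_one)
    have V0: "V x = 0" if "x \<notin> ball c R" for x
      using u0[of x] that u01(1)[of x] by (simp add: V_def)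
    have contw: "continuous_on UNIV w" unfolding w_def by (intro continuous_intros)
    have contu: "continuous_on UNIV u" unfolding u_def by (intro continuous_intros contw)
    have contV: "continuous_on UNIV V" unfolding V_def by (intro continuous_intros contu)
    have Dw: "(w has_derivative (\<lambda>v. (1 / R) *\<^sub>R v)) (at x)" for x
      unfolding w_def by (auto intro!: derivative_eq_intros)
    have DV: "(V has_derivative V' x) (at x)" for x
      using has_derivative_cutoff[of R c x] by (simp only: V_def V'_def u_def w_def)
    have D\<psi>: "(\<psi> m has_derivative (\<lambda>v. (1 - V x) ^ Suc m *\<^sub>R ?D x v
        - (real (Suc m) * (1 - V x) ^ m * V' x v) *\<^sub>R (\<phi> x + w x)
        - ((1 - (1 - V x) ^ Suc m) / R) *\<^sub>R v)) (at x)" for m x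
      unfolding \<psi>_def
      apply (rule derivative_eq_intros Dw DV C1_compact_support_has_derivative[OF \<phi>(1)] refl)+
      apply (simp add: fun_eq_iff algebra_simps divide_simps scaleR_diff_left scaleR_add_left)
      done
    have cont: "continuous_on UNIV (\<lambda>x. (1 - V x) ^ Suc m *\<^sub>R ?D x v
        - (real (Suc m) * (1 - V x) ^ m * V' x v) *\<^sub>R (\<phi> x + w x)
        - ((1 - (1 - V x) ^ Suc m) / R) *\<^sub>R v)" for m v
    proof -
      have "continuous_on UNIV \<phi>"
        using \<phi>(1) unfolding C1_compact_support_def
        by (meson differentiable_imp_continuous_within continuous_at_imp_continuous_on)
      moreover have "continuous_on UNIV (\<lambda>x. ?D x v)"
        using \<phi>(1) by (simp add: C1_compact_support_def)
      ultimately show ?thesis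
        unfolding V'_def using R by (intro continuous_intros contV contw contu) auto
    qed
    have \<psi>C1: "C1_compact_support (\<psi> m)" for m
    proof (rule C1_compact_supportI[OF D\<psi> cont])
      show "bounded ({x. \<phi> x \<noteq> 0} \<union> ball c R)"
        using \<phi>(1) unfolding C1_compact_support_def
        by (meson bounded_Un bounded_ball bounded_subset closure_subset compact_imp_bounded)
      show "\<psi> m x = 0" if "x \<notin> {x. \<phi> x \<noteq> 0} \<union> ball c R" for x
        using that V0[of x] by (simp add: \<psi>_def)
    qed
    \<comment> \<open>Inside the ball \<open>\<psi> m x\<close> is a convex combination of
      \<open>\<phi> x\<close> and \<open>- w x\<close>, both of norm at most 1; outside it equals
      \<open>\<phi> x\<close>.\<close>
    have \<psi>1: "norm (\<psi> m x) \<le> 1" for m x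
    proof (cases "x \<in> ball c R")
      case True
      let ?a = "(1 - V x) ^ Suc m"
      have a: "0 \<le> ?a" "?a \<le> 1" using V01[of x] by (simp_all add: power_le_one del: power_Suc)
      have "norm (\<psi> m x) \<le> norm (?a *\<^sub>R \<phi> x) + norm ((1 - ?a) *\<^sub>R w x)"
        unfolding \<psi>_def by (rule norm_triangle_ineq4)
      also have "\<dots> \<le> ?a * 1 + (1 - ?a) * 1"
        using a w1[of x] True \<phi>(2) unfolding norm_scaleR
        by (intro add_mono mult_mono) auto
      finally show ?thesis by simp
    next
      case False
      then show ?thesis using V0 \<phi>(2) by (simp add: \<psi>_def)
    qed
    have div: "g m x \<le> divergence (\<psi> m) x" for m x
    proof -
      let ?k = "real (Suc m) * (1 - V x) ^ m"
      have k: "0 \<le> ?k" using V01[of x] by simp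
      have e1: "divergence (\<psi> m) x = (1 - V x) ^ Suc m * divergence \<phi> x
          - ?k * (\<Sum>b\<in>Basis. V' x b * ((\<phi> x + w x) \<bullet> b)) - (1 - (1 - V x) ^ Suc m) * (DIM('a) / R)"
      proof -
        have "divergence (\<psi> m) x = (\<Sum>b\<in>Basis. (1 - V x) ^ Suc m * (?D x b \<bullet> b)
            - ?k * (V' x b * ((\<phi> x + w x) \<bullet> b)) - (1 - (1 - V x) ^ Suc m) / R)"
          by (subst divergence_eq[OF D\<psi>])
            (simp only: inner_diff_left inner_scaleR_left mult.assoc inner_same_Basis mult_1_right cong: sum.cong)
        then show ?thesis
          by (simp only: sum_subtractf sum_distrib_left[symmetric] divergence_def sum_constant) simp
      qed
      have e2: "(\<Sum>b\<in>Basis. V' x b * ((\<phi> x + w x) \<bullet> b)) = - (4 * u x / R) * (w x \<bullet> (\<phi> x + w x))"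
        by (subst euclidean_inner) (simp add: V'_def sum_distrib_left mult_ac)
      have e3: "?k * (- (4 * u x / R) * (w x \<bullet> (\<phi> x + w x))) \<le> ?k * ((4 / R) * V x)"
      proof (rule mult_left_mono[OF _ k])
        \<comment> \<open>In the ball \<open>- (w x \<bullet> \<phi> x)\<close> is at most 1, so the
          left side is at most \<open>u x\<close> times \<open>1 - w x \<bullet> w x\<close>. That
          second factor is again at most \<open>u x\<close>, and the product is
          \<open>V x\<close>.\<close>
        have "- (u x * (w x \<bullet> (\<phi> x + w x))) \<le> V x"
        proof (cases "x \<in> ball c R")
          case True
          have n: "norm (w x) \<le> 1" using w1[of x] True by simp
          have "- (w x \<bullet> \<phi> x) \<le> norm (w x) * norm (\<phi> x)"
            using Cauchy_Schwarz_ineq2[of "w x" "\<phi> x"] by linarith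
          also have "\<dots> \<le> norm (w x) * 1" using \<phi>(2) by (intro mult_left_mono) auto
          finally have "- (w x \<bullet> (\<phi> x + w x)) \<le> 1 - w x \<bullet> w x"
            using n by (simp add: inner_add_right)
          also have "\<dots> \<le> u x" by (simp add: u_def)
          finally show ?thesis
            using mult_left_mono[OF _ u01(1)[of x]] by (fastforce simp: V_def power2_eq_square)
        next
          case False
          then show ?thesis using V0[OF False] by (simp add: V_def)
        qed
        then show "- (4 * u x / R) * (w x \<bullet> (\<phi> x + w x)) \<le> (4 / R) * V x"
          using R mult_left_mono[of "- (u x * (w x \<bullet> (\<phi> x + w x)))" "V x" "4 / R"] by simp
      qed
      have "?k * (4 / R * V x) = 4 / R * (real (Suc m) * V x * (1 - V x) ^ m)" by (simp add: mult_ac)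
      with e3 show ?thesis unfolding g_def e1 e2 by linarith
    qed
    obtain B where B: "0 \<le> B" "\<And>x. \<bar>divergence \<phi> x\<bar> \<le> B"
      using divergence_bounded[OF \<phi>(1)] by blast
    have Vmeas: "V \<in> borel_measurable lebesgue"
      using contV by (intro measurable_completion) (simp add: borel_measurable_continuous_onI)
    have gmeas: "g m \<in> borel_measurable lebesgue" for m
      unfolding g_def by (intro borel_measurable_diff borel_measurable_times borel_measurable_power
          borel_measurable_const Vmeas divergence_measurable[OF \<phi>(1)])
    have gB: "\<bar>g m x\<bar> \<le> B + DIM('a) / R + 4 / R" for m x
    proof -
      let ?a = "(1 - V x) ^ Suc m"
      have a: "0 \<le> ?a" "?a \<le> 1" using V01[of x] by (simp_all add: power_le_one del: power_Suc)
      have 1: "\<bar>?a * divergence \<phi> x\<bar> \<le> 1 * B"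
        unfolding abs_mult using a B by (intro mult_mono) auto
      have 2: "\<bar>(1 - ?a) * (DIM('a) / R)\<bar> \<le> 1 * (DIM('a) / R)"
        unfolding abs_mult using a R by (intro mult_mono) auto
      have 3: "\<bar>4 / R * (real (Suc m) * V x * (1 - V x) ^ m)\<bar> \<le> 4 / R * 1"
        using Suc_mult_power_le_1[OF V01[of x], of m] V01[of x] R
        unfolding abs_mult by (intro mult_mono) auto
      show ?thesis using 1 2 3 unfolding g_def by linarith
    qed
    have gint: "(LINT x:F|lebesgue. g m x) \<le> p" for m
    proof -
      have "(LINT x:F|lebesgue. g m x) \<le> (LINT x:F|lebesgue. divergence (\<psi> m) x)"
        using set_integrable_bounded[OF F gmeas gB] set_integrable_divergence[OF \<psi>C1 F] div
        by (intro set_integral_mono) auto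
      also have "\<dots> \<le> p"
        using p(1) \<psi>C1 \<psi>1 unfolding perimeter_le_iff[OF p(2)] by blast
      finally show ?thesis .
    qed
    let ?G = "\<lambda>x. indicator (F - ball c R) x *\<^sub>R divergence \<phi> x - (DIM('a) / R) * indicator (F \<inter> ball c R) x"
    \<comment> \<open>In the open ball \<open>V x\<close> is positive and all powers of
      \<open>1 - V x\<close> die out, leaving \<open>- d / R\<close>. Off the ball
      \<open>V x = 0\<close> and \<open>g m x\<close> is the divergence of \<phi> for every
      \<open>m\<close>.\<close>
    have lim: "(\<lambda>m. indicator F x *\<^sub>R g m x) \<longlonglongrightarrow> ?G x" for x
    proof (cases "x \<in> ball c R")
      case True
      have "V x > 0" using u0[of x] True by (simp add: V_def)
      then have v: "norm (1 - V x) < 1" using V01[of x] by simp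
      have l1: "(\<lambda>m. (1 - V x) ^ Suc m) \<longlonglongrightarrow> 0"
        using LIMSEQ_power_zero[OF v] by (rule LIMSEQ_Suc)
      have "(\<lambda>m. real m * (1 - V x) ^ m + (1 - V x) ^ m) \<longlonglongrightarrow> 0 + 0"
        by (intro tendsto_add powser_times_n_limit_0 LIMSEQ_power_zero v)
      then have l2: "(\<lambda>m. V x * (real m * (1 - V x) ^ m + (1 - V x) ^ m)) \<longlonglongrightarrow> V x * (0 + 0)"
        by (rule tendsto_mult[OF tendsto_const])
      have "(\<lambda>m. indicator F x *\<^sub>R ((1 - V x) ^ Suc m * divergence \<phi> x - (1 - (1 - V x) ^ Suc m) * (DIM('a) / R)
         - 4 / R * (V x * (real m * (1 - V x) ^ m + (1 - V x) ^ m))))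
         \<longlonglongrightarrow> indicator F x *\<^sub>R (0 * divergence \<phi> x - (1 - 0) * (DIM('a) / R) - 4 / R * (V x * (0 + 0)))"
        by (intro tendsto_intros l1 l2)
      moreover have "(\<lambda>m. indicator F x *\<^sub>R ((1 - V x) ^ Suc m * divergence \<phi> x - (1 - (1 - V x) ^ Suc m) * (DIM('a) / R)
         - 4 / R * (V x * (real m * (1 - V x) ^ m + (1 - V x) ^ m)))) = (\<lambda>m. indicator F x *\<^sub>R g m x)"
        unfolding g_def by (simp add: algebra_simps del: power_Suc)
      ultimately show ?thesis using True by (cases "x \<in> F") (simp_all add: indicator_def)
    next
      case False
      then show ?thesis using V0[OF False] by (simp add: g_def indicator_def)
    qed
    have Gmeas: "?G \<in> borel_measurable lebesgue"
      using F divergence_measurable[OF \<phi>(1)] by (intro borel_measurable_diff borel_measurable_scaleR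
         borel_measurable_times borel_measurable_const borel_measurable_indicator) auto
    have "(\<lambda>m. LINT x|lebesgue. indicator F x *\<^sub>R g m x) \<longlonglongrightarrow> (LINT x|lebesgue. ?G x)"
    proof (rule integral_dominated_convergence[where w = "\<lambda>x. (B + DIM('a) / R + 4 / R) * indicator F x"])
      show "integrable lebesgue (\<lambda>x. (B + DIM('a) / R + 4 / R) * indicator F x)"
        using F by (intro integrable_mult_right) (auto simp: integrable_indicator_iff fmeasurable_def)
      show "AE x in lebesgue. norm (indicator F x *\<^sub>R g m x) \<le> (B + DIM('a) / R + 4 / R) * indicator F x" for m
        using gB by (intro AE_I2) (auto simp: indicator_def)
      show "(\<lambda>x. indicator F x *\<^sub>R g m x) \<in> borel_measurable lebesgue" for m
        using F gmeas by (intro borel_measurable_scaleR) auto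
    qed (use lim Gmeas in auto)
    then have "(LINT x|lebesgue. ?G x) \<le> p"
      by (rule LIMSEQ_le_const2) (use gint in \<open>auto simp: set_lebesgue_integral_def\<close>)
    moreover have "(LINT x|lebesgue. ?G x) = (LINT x:F - ball c R|lebesgue. divergence \<phi> x)
        - DIM('a) / R * measure lebesgue (F \<inter> ball c R)"
    proof -
      have 1: "F - ball c R \<in> lmeasurable" "F \<inter> ball c R \<in> lmeasurable"
        using F by (auto intro: fmeasurable_Diff fmeasurable.Int)
      show ?thesis
        using set_integrable_divergence[OF \<phi>(1) 1(1)] 1(2)
        unfolding set_integrable_def set_lebesgue_integral_def
        by (subst Bochner_Integration.integral_diff)
          (auto simp: integrable_indicator_iff fmeasurable_def intro!: integrable_mult_right)
    qed
    ultimately show ?thesis by linarith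
  qed
  then show ?thesis using p(2) R by (subst perimeter_le_iff) auto
qed

subsection \<open>Exterior balls and cones\<close>

text \<open>A point of \<open>closure \<Omega>\<close> lies in no open ball disjoint from \<Omega>,
  so only the complement of the closure can be covered. The lower bound \<open>R\<close> on the
  radii is common to all \<open>x\<close> near \<open>p\<close>.\<close>

definition exterior_ball_at :: "'a::euclidean_space set \<Rightarrow> 'a \<Rightarrow> bool" where
  "exterior_ball_at \<Omega> p \<longleftrightarrow> (\<exists>r>0. \<exists>R>0. \<forall>x \<in> ball p r - closure \<Omega>.
     \<exists>c R'. R \<le> R' \<and> x \<in> ball c R' \<and> ball c R' \<inter> \<Omega> = {})"

text \<open>The cone at \<open>x\<close> is the union of balls of radius \<open>\<kappa> * s\<close>
  around \<open>x + s *\<^sub>R \<nu>\<close>. Axis, opening and height are the same for all apexes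
  near \<open>p\<close>, so that translations along \<nu> can be used.\<close>

definition exterior_cone_at :: "'a::euclidean_space set \<Rightarrow> 'a \<Rightarrow> bool" where
  "exterior_cone_at \<Omega> p \<longleftrightarrow> (\<exists>r>0. \<exists>\<kappa>>0. \<exists>\<nu>. norm \<nu> = 1 \<and> (\<forall>x \<in> ball p r - \<Omega>.
     \<forall>s w. 0 < s \<longrightarrow> s < r \<longrightarrow> norm w \<le> \<kappa> * s \<longrightarrow> x + s *\<^sub>R \<nu> + w \<notin> \<Omega>))"

lemma exterior_cone_atI:
  assumes "0 < r" "0 < \<kappa>" "norm \<nu> = 1"
    and "\<And>x s w. \<lbrakk>x \<in> ball p r; x \<notin> \<Omega>; 0 < s; s < r; norm w \<le> \<kappa> * s\<rbrakk> \<Longrightarrow> x + s *\<^sub>R \<nu> + w \<notin> \<Omega>"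
  shows "exterior_cone_at \<Omega> p"
  unfolding exterior_cone_at_def using assms by (meson DiffE)

text \<open>The half space beyond the nearest point \<open>q\<close>, orthogonal to
  \<open>x - q\<close>, misses \<Omega>. It contains arbitrarily large balls that touch its boundary
  at \<open>q\<close>.\<close>

lemma convex_exterior_ball_at:
  assumes "convex \<Omega>" "\<Omega> \<noteq> {}"
  shows "exterior_ball_at \<Omega> p"
proof -
  have "\<exists>c R'. 1 \<le> R' \<and> x \<in> ball c R' \<and> ball c R' \<inter> \<Omega> = {}" if "x \<notin> closure \<Omega>" for x
  proof -
    define q where "q = closest_point (closure \<Omega>) x"
    have "q \<in> closure \<Omega>"
      unfolding q_def using assms by (intro closest_point_in_set) auto
    with that have xq: "x - q \<noteq> 0" by auto
    \<comment> \<open>\<open>l \<ge> 1\<close> puts \<open>x\<close> into the ball around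
      \<open>q + l *\<^sub>R (x - q)\<close> through \<open>q\<close>; the other bound makes its
      radius at least 1.\<close>
    define l where "l = max 1 (1 / norm (x - q))"
    have l: "1 \<le> l" "1 \<le> l * norm (x - q)"
      using xq by (auto simp: l_def max_def field_simps)
    have "x \<in> ball (q + l *\<^sub>R (x - q)) (l * norm (x - q))"
    proof -
      have "q + l *\<^sub>R (x - q) - x = (l - 1) *\<^sub>R (x - q)" by (simp add: algebra_simps)
      then have "dist (q + l *\<^sub>R (x - q)) x = (l - 1) * norm (x - q)"
        using l(1) by (simp add: dist_norm)
      moreover have "norm (x - q) > 0" using xq by simp
      ultimately show ?thesis unfolding mem_ball left_diff_distrib by linarith
    qed
    \<comment> \<open>Expanding the square, membership in the ball forces a positive inner product
      of \<open>z - q\<close> with \<open>x - q\<close>, which the nearest point property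
      excludes.\<close>
    moreover have "z \<notin> \<Omega>" if z: "z \<in> ball (q + l *\<^sub>R (x - q)) (l * norm (x - q))" for z
    proof
      assume "z \<in> \<Omega>"
      then have *: "(x - q) \<bullet> (z - q) \<le> 0"
        unfolding q_def using assms(1) closure_subset
        by (intro closest_point_dot) auto
      have "norm (l *\<^sub>R (x - q) - (z - q)) < norm (l *\<^sub>R (x - q))"
        using z l(1) by (simp add: dist_norm add_diff_eq diff_diff_eq2 add.commute)
      then have "(norm (l *\<^sub>R (x - q) - (z - q)))\<^sup>2 < (norm (l *\<^sub>R (x - q)))\<^sup>2"
        by (simp add: power_strict_mono)
      then have "(z - q) \<bullet> (z - q) < 2 * l * ((x - q) \<bullet> (z - q))"
        unfolding power2_norm_eq_inner by (simp add: inner_diff_left inner_diff_right inner_commute algebra_simps)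
      moreover have "2 * l * ((x - q) \<bullet> (z - q)) \<le> 0"
        using * l(1) by (simp add: mult_nonneg_nonpos)
      ultimately show False using inner_ge_zero[of "z - q"] by linarith
    qed
    ultimately show ?thesis using l(2) by blast
  qed
  then show ?thesis unfolding exterior_ball_at_def by (meson DiffD2 zero_less_one)
qed

text \<open>The axis points from an interior point \<open>a\<close> to \<open>p\<close>. If a point
  of the cone at \<open>x\<close> were in \<Omega>, then \<open>x\<close> would lie between it and a
  point of a ball around \<open>a\<close> inside \<Omega>, hence in \<Omega> by convexity.\<close>

lemma convex_exterior_cone_at:
  fixes \<Omega> :: "'a::euclidean_space set"
  assumes "open \<Omega>" "convex \<Omega>" "\<Omega> \<noteq> {}" "p \<in> frontier \<Omega>"
  shows "exterior_cone_at \<Omega> p"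
proof -
  obtain a where a: "a \<in> \<Omega>" using assms(3) by blast
  obtain \<rho> where \<rho>: "\<rho> > 0" "ball a \<rho> \<subseteq> \<Omega>" using a assms(1) open_contains_ball by blast
  have "p \<notin> \<Omega>" using assms(1,4) by (simp add: frontier_def interior_open)
  with a have pa: "norm (p - a) > 0" by auto
  define \<nu> where "\<nu> = (1 / norm (p - a)) *\<^sub>R (p - a)"
  define \<kappa> where "\<kappa> = \<rho> / (2 * norm (p - a))"
  have "x + s *\<^sub>R \<nu> + w \<notin> \<Omega>"
    if x: "x \<in> ball p (\<rho> / 2)" "x \<notin> \<Omega>" and s: "0 < s" and w: "norm w \<le> \<kappa> * s" for x s w
  proof
    assume z: "x + s *\<^sub>R \<nu> + w \<in> \<Omega>"
    \<comment> \<open>Extending the segment from the cone point through \<open>x\<close> by the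
      factor \<open>l\<close> ends at \<open>b\<close>. Since \<open>l * s\<close> is the distance
      from \<open>a\<close> to \<open>p\<close>, \<open>b - a\<close> reduces to
      \<open>(x - p) - l *\<^sub>R w\<close>, and \<kappa> makes both terms at most half of
      \<rho>.\<close>
    define l where "l = norm (p - a) / s"
    have l: "0 < l" using pa s by (simp add: l_def)
    define b where "b = x - l *\<^sub>R (s *\<^sub>R \<nu> + w)"
    have "l *\<^sub>R s *\<^sub>R \<nu> = p - a" using s pa by (simp add: l_def \<nu>_def)
    then have b: "b = a + ((x - p) - l *\<^sub>R w)" by (simp add: b_def algebra_simps)
    have "norm (l *\<^sub>R w) \<le> l * (\<kappa> * s)" using w l by (simp add: mult_left_mono)
    also have "\<dots> = \<rho> / 2" using s pa by (simp add: l_def \<kappa>_def)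
    finally have "norm (l *\<^sub>R w) \<le> \<rho> / 2" .
    moreover have "norm (x - p) < \<rho> / 2" using x(1) by (simp add: dist_norm norm_minus_commute)
    ultimately have "norm ((x - p) - l *\<^sub>R w) < \<rho>"
      using norm_triangle_ineq4[of "x - p" "l *\<^sub>R w"] by linarith
    then have "b \<in> ball a \<rho>" by (simp add: b dist_norm norm_minus_commute)
    with \<rho>(2) have "b \<in> \<Omega>" by blast
    then have "(l / (1 + l)) *\<^sub>R (x + s *\<^sub>R \<nu> + w) + (1 / (1 + l)) *\<^sub>R b \<in> \<Omega>"
      using z l assms(2) by (intro convexD) (auto simp: field_simps)
    also have "(l / (1 + l)) *\<^sub>R (x + s *\<^sub>R \<nu> + w) + (1 / (1 + l)) *\<^sub>R b = x"
    proof -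
      have "(l / (1 + l)) *\<^sub>R (x + s *\<^sub>R \<nu> + w) + (1 / (1 + l)) *\<^sub>R b
          = (l / (1 + l) + 1 / (1 + l)) *\<^sub>R x"
        by (simp add: b_def algebra_simps)
      also have "l / (1 + l) + 1 / (1 + l) = 1" using l by (simp add: field_simps)
      finally show ?thesis by simp
    qed
    finally show False using x(2) by simp
  qed
  then show ?thesis
    using \<rho>(1) pa by (intro exterior_cone_atI[of "\<rho> / 2" \<kappa> \<nu>]) (simp_all add: \<kappa>_def \<nu>_def)
qed

text \<open>The cone comes from a Lipschitz bound for the graph function. The ball comes from a
  second order bound: a small enough ball touching the graph from above stays above it.\<close>

lemma C11_boundary_exterior_ball_cone_at:
  fixes \<Omega> :: "'a::euclidean_space set"
  assumes "C11_boundary \<Omega>" "p \<in> frontier \<Omega>"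
  shows "exterior_ball_at \<Omega> p \<and> exterior_cone_at \<Omega> p"
proof -
  obtain \<nu> r h \<gamma> where \<nu>: "norm \<nu> = 1" and r: "0 < r" and h: "0 < h"
    and C11: "C11_on {y. y \<bullet> \<nu> = 0 \<and> norm y < r} \<gamma>"
    and graph: "\<And>y t. y \<bullet> \<nu> = 0 \<Longrightarrow> norm y < r \<Longrightarrow> \<bar>t\<bar> < h \<Longrightarrow>
           (p + y + t *\<^sub>R \<nu> \<in> \<Omega> \<longleftrightarrow> t < \<gamma> y) \<and> (p + y + t *\<^sub>R \<nu> \<in> frontier \<Omega> \<longleftrightarrow> t = \<gamma> y)"
    using assms unfolding C11_boundary_def by blast
  define D where "D = {y. y \<bullet> \<nu> = 0 \<and> norm y < r}"
  obtain G L where G: "\<And>y. y \<in> D \<Longrightarrow> (\<gamma> has_derivative (\<lambda>v. G y \<bullet> v)) (at y within D)"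
    and L: "L-lipschitz_on D G"
    using C11 unfolding C11_on_def D_def by blast
  have L0: "0 \<le> L" using L by (simp add: lipschitz_on_def)
  have D0: "0 \<in> D" using r by (simp add: D_def)
  have convD: "convex D"
  proof -
    have "D = {y. \<nu> \<bullet> y = 0} \<inter> ball 0 r" by (auto simp: D_def inner_commute)
    then show ?thesis by (metis convex_Int convex_ball convex_hyperplane)
  qed
  define B where "B = norm (G 0) + L * r"
  have B0: "0 \<le> B" using L0 r by (simp add: B_def)
  have onorm_inner: "onorm (\<lambda>v. a \<bullet> v) \<le> b" if "norm a \<le> b" for a :: 'a and b
  proof (rule onorm_bound)
    show "norm (a \<bullet> x) \<le> b * norm x" for x
      using Cauchy_Schwarz_ineq2[of a x] that mult_right_mono[OF that, of "norm x"] by simp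
    show "0 \<le> b" using that norm_ge_zero order_trans by blast
  qed
  have GB: "norm (G y) \<le> B" if "y \<in> D" for y
  proof -
    have "norm (G y - G 0) \<le> L * norm (y - 0)"
      using lipschitz_on_normD[OF L] that D0 by blast
    also have "\<dots> \<le> L * r" using that L0 by (intro mult_left_mono) (auto simp: D_def)
    finally show ?thesis unfolding B_def using norm_triangle_ineq2[of "G y" "G 0"] by linarith
  qed
  have \<gamma>_lip: "\<bar>\<gamma> z - \<gamma> y\<bar> \<le> B * norm (z - y)" if "y \<in> D" "z \<in> D" for y z
    using differentiable_bound[OF convD G onorm_inner[OF GB]] that by simp
  \<comment> \<open>Subtracting the linear part at \<open>y\<close> leaves the derivative
    \<open>G x - G y\<close>, of norm at most \<open>L * norm (z - y)\<close> on the segment; the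
    mean value inequality does the rest.\<close>
  have taylor: "\<bar>\<gamma> z - \<gamma> y - G y \<bullet> (z - y)\<bar> \<le> L * norm (z - y) * norm (z - y)"
    if y: "y \<in> D" and z: "z \<in> D" for y z
  proof -
    let ?S = "closed_segment y z"
    have SD: "?S \<subseteq> D" using convD y z closed_segment_subset by blast
    have "norm ((\<gamma> z - G y \<bullet> z) - (\<gamma> y - G y \<bullet> y)) \<le> (L * norm (z - y)) * norm (z - y)"
    proof (rule differentiable_bound[where S = ?S and f' = "\<lambda>x v. (G x - G y) \<bullet> v"])
      fix x assume x: "x \<in> ?S"
      have "(\<gamma> has_derivative (\<lambda>v. G x \<bullet> v)) (at x within ?S)"
        using G x SD has_derivative_subset by blast
      then show "((\<lambda>x. \<gamma> x - G y \<bullet> x) has_derivative (\<lambda>v. (G x - G y) \<bullet> v)) (at x within ?S)"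
        by (auto intro!: derivative_eq_intros simp: inner_diff_left)
      have "norm (G x - G y) \<le> L * norm (x - y)"
        using lipschitz_on_normD[OF L] x SD y by blast
      also have "\<dots> \<le> L * norm (z - y)"
        using L0 segment_bound(1)[OF x] by (intro mult_left_mono) (auto simp: norm_minus_commute)
      finally show "onorm (\<lambda>v. (G x - G y) \<bullet> v) \<le> L * norm (z - y)" by (rule onorm_inner)
    qed auto
    then show ?thesis by (simp add: inner_diff_right algebra_simps)
  qed
  \<comment> \<open>\<open>T\<close> and \<open>Y\<close> are the height and the horizontal part in
    the frame at \<open>p\<close>. Both are 1-Lipschitz, so \<open>ball p m\<close> lies in the
    cylinder where the graph description holds.\<close>
  define T where "T = (\<lambda>z. (z - p) \<bullet> \<nu>)"
  define Y where "Y = (\<lambda>z. (z - p) - T z *\<^sub>R \<nu>)"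
  define m where "m = min r h"
  have m: "0 < m" using r h by (simp add: m_def)
  have \<nu>\<nu>: "\<nu> \<bullet> \<nu> = 1" using \<nu> by (simp add: norm_eq_1)
  have Y\<nu>: "Y z \<bullet> \<nu> = 0" for z by (simp add: Y_def T_def inner_diff_left \<nu>\<nu>)
  have T_le: "\<bar>T z - T x\<bar> \<le> norm (z - x)" for z x
    using Cauchy_Schwarz_ineq2[of "z - x" \<nu>] \<nu> by (simp add: T_def inner_diff_left)
  have YY: "Y z - Y x = (z - x) - ((z - x) \<bullet> \<nu>) *\<^sub>R \<nu>" for z x
    by (simp add: Y_def T_def algebra_simps inner_diff_left)
  have Y_le: "norm (Y z - Y x) \<le> norm (z - x)" for z x
  proof -
    have "(norm (Y z - Y x))\<^sup>2 = (norm (z - x))\<^sup>2 - ((z - x) \<bullet> \<nu>)\<^sup>2"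
      unfolding YY power2_norm_eq_inner
      by (simp add: inner_diff_left inner_diff_right \<nu>\<nu> inner_commute power2_eq_square algebra_simps)
    then have "(norm (Y z - Y x))\<^sup>2 \<le> (norm (z - x))\<^sup>2" by simp
    then show ?thesis by (rule power2_le_imp_le) simp
  qed
  have Yp: "Y p = 0" "T p = 0" by (simp_all add: Y_def T_def)
  have Y_in: "Y z \<in> D" and graph_in: "z \<in> \<Omega> \<longleftrightarrow> T z < \<gamma> (Y z)"
    and graph_frontier: "z \<in> frontier \<Omega> \<longleftrightarrow> T z = \<gamma> (Y z)"
    if "z \<in> ball p m" for z
  proof -
    have *: "norm (z - p) < m" using that by (simp add: dist_norm norm_minus_commute)
    have 1: "norm (Y z) < r" using Y_le[of z p] * by (simp add: Yp m_def)
    have 2: "\<bar>T z\<bar> < h" using T_le[of z p] * by (simp add: Yp m_def)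
    have "p + Y z + T z *\<^sub>R \<nu> = z" by (simp add: Y_def)
    with graph[OF Y\<nu>[of z] 1 2]
    show "z \<in> \<Omega> \<longleftrightarrow> T z < \<gamma> (Y z)" "z \<in> frontier \<Omega> \<longleftrightarrow> T z = \<gamma> (Y z)" by auto
    show "Y z \<in> D" using 1 Y\<nu> by (simp add: D_def)
  qed
  have \<gamma>0: "\<gamma> 0 = 0"
    using graph_frontier[of p] assms(2) m by (simp add: Yp)
  have cone: "exterior_cone_at \<Omega> p"
  proof -
    \<comment> \<open>With this opening \<open>(1 + B) * norm w \<le> s\<close>: the net rise, at
      least \<open>s - norm w\<close>, is not smaller than the possible increase
      \<open>B * norm w\<close> of \<gamma>.\<close>
    define \<kappa> where "\<kappa> = 1 / (1 + B)"
    have \<kappa>: "0 < \<kappa>" "\<kappa> \<le> 1" "\<kappa> * (1 + B) = 1" using B0 by (auto simp: \<kappa>_def field_simps)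
    have "x + s *\<^sub>R \<nu> + w \<notin> \<Omega>"
      if x: "x \<in> ball p (m / 3)" "x \<notin> \<Omega>" and s: "0 < s" "s < m / 3" and w: "norm w \<le> \<kappa> * s" for x s w
    proof -
      let ?z = "x + s *\<^sub>R \<nu> + w"
      have ws: "norm w \<le> s" using w mult_right_mono[OF \<kappa>(2), of s] s by linarith
      have xp: "norm (x - p) < m / 3" using x(1) by (simp add: dist_norm norm_minus_commute)
      have "norm (?z - p) \<le> norm (x - p) + norm (s *\<^sub>R \<nu>) + norm w"
        using norm_triangle_ineq[of "x - p + s *\<^sub>R \<nu>" w] norm_triangle_ineq[of "x - p" "s *\<^sub>R \<nu>"]
        by (simp add: algebra_simps)
      also have "\<dots> < m" using ws xp s \<nu> by simp
      finally have z: "?z \<in> ball p m" by (simp add: dist_norm norm_minus_commute)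
      have x': "x \<in> ball p m" using x(1) m by auto
      have Yz: "norm (Y ?z - Y x) \<le> norm w"
      proof -
        have "Y ?z - Y x = Y (x + w) - Y x" by (simp add: YY inner_add_left \<nu>\<nu> algebra_simps)
        then show ?thesis using Y_le[of "x + w" x] by simp
      qed
      have "\<gamma> (Y ?z) \<le> \<gamma> (Y x) + B * norm w"
        using \<gamma>_lip[OF Y_in[OF x'] Y_in[OF z]] mult_left_mono[OF Yz B0] by linarith
      also have "\<dots> \<le> T x + B * norm w" using graph_in[OF x'] x(2) by simp
      also have "\<dots> \<le> T x + s - norm w"
      proof -
        have "norm w * (1 + B) \<le> \<kappa> * s * (1 + B)" using w B0 by (intro mult_right_mono) auto
        also have "\<dots> = \<kappa> * (1 + B) * s" by (simp add: mult_ac)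
        also have "\<dots> = s" unfolding \<kappa>(3) by simp
        finally show ?thesis by (simp add: algebra_simps)
      qed
      also have "\<dots> \<le> T ?z"
        using Cauchy_Schwarz_ineq2[of w \<nu>] \<nu> by (simp add: T_def inner_add_left inner_diff_left \<nu>\<nu>)
      finally show ?thesis using graph_in[OF z] by simp
    qed
    then show ?thesis using m \<kappa>(1) \<nu>
      by (intro exterior_cone_atI[of "m / 3" \<kappa> \<nu>]) simp_all
  qed
  \<comment> \<open>The first bound lets the curvature of the ball dominate the Taylor error, with
    \<open>L + 1\<close> avoiding a division by 0. The second keeps the ball inside the
    chart.\<close>
  define \<rho> where "\<rho> = min (1 / (2 * (L + 1))) (m / (4 * (1 + B)))"
  have \<rho>0: "0 < \<rho>" using L0 B0 m by (simp add: \<rho>_def)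
  have \<rho>L: "2 * \<rho> * L \<le> 1"
  proof -
    have "2 * \<rho> * L \<le> 2 * (1 / (2 * (L + 1))) * L"
      using L0 by (intro mult_right_mono mult_left_mono) (auto simp: \<rho>_def)
    also have "\<dots> \<le> 1" using L0 by (simp add: field_simps)
    finally show ?thesis .
  qed
  have \<rho>m: "4 * \<rho> * (1 + B) \<le> m"
  proof -
    have "4 * \<rho> * (1 + B) \<le> 4 * (m / (4 * (1 + B))) * (1 + B)"
      using B0 by (intro mult_right_mono mult_left_mono) (auto simp: \<rho>_def)
    also have "\<dots> = m" using B0 by (simp add: field_simps)
    finally show ?thesis .
  qed
  have \<rho>m': "4 * \<rho> \<le> m" using \<rho>m mult_left_mono[of 1 "1 + B" "4 * \<rho>"] B0 \<rho>0 by linarith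
  define r' where "r' = \<rho> / (1 + B)"
  have r': "0 < r'" "r' \<le> \<rho>" "(1 + B) * r' = \<rho>" using \<rho>0 B0 by (auto simp: r'_def field_simps)
  have ball: "\<exists>c R'. \<rho> \<le> R' \<and> x \<in> ball c R' \<and> ball c R' \<inter> \<Omega> = {}"
    if x: "x \<in> ball p r'" "x \<notin> closure \<Omega>" for x
  proof -
    have xm: "x \<in> ball p m" using x(1) r' \<rho>m' \<rho>0 by auto
    have xp: "norm (x - p) < r'" using x(1) by (simp add: dist_norm norm_minus_commute)
    have YxD: "Y x \<in> D" using xm by (rule Y_in)
    have "x \<notin> \<Omega>" "x \<notin> frontier \<Omega>" using x(2) closure_subset by (auto simp: frontier_def)
    then have above: "\<gamma> (Y x) < T x" using graph_in[OF xm] graph_frontier[OF xm] by simp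
    define s where "s = T x - \<gamma> (Y x)"
    have \<gamma>x: "\<bar>\<gamma> (Y x)\<bar> \<le> B * norm (x - p)"
      using \<gamma>_lip[OF D0 YxD] mult_left_mono[OF Y_le[of x p] B0] by (simp add: \<gamma>0 Yp)
    have s: "0 < s" "s < 2 * \<rho>"
    proof -
      show "0 < s" using above by (simp add: s_def)
      have "s \<le> (1 + B) * norm (x - p)"
        using \<gamma>x T_le[of x p] by (simp add: s_def Yp algebra_simps)
      also have "\<dots> \<le> (1 + B) * r'" using xp B0 by (intro mult_left_mono) auto
      finally show "s < 2 * \<rho>" using r'(3) \<rho>0 by simp
    qed
    \<comment> \<open>\<open>q\<close> is the graph point vertically below \<open>x\<close>.
      Removing the component of the gradient along \<nu>, which carries no information, gives
      \<open>g\<close>, and \<open>n\<close> is the upward normal at \<open>q\<close>, scaled to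
      have height 1.\<close>
    define q where "q = x - s *\<^sub>R \<nu>"
    define g where "g = G (Y x) - (G (Y x) \<bullet> \<nu>) *\<^sub>R \<nu>"
    define n where "n = \<nu> - g"
    have g\<nu>: "g \<bullet> \<nu> = 0" by (simp add: g_def inner_diff_left \<nu>\<nu>)
    have n\<nu>: "n \<bullet> \<nu> = 1" by (simp add: n_def inner_diff_left g\<nu> \<nu>\<nu>)
    have n1: "1 \<le> norm n"
      using Cauchy_Schwarz_ineq2[of n \<nu>] by (simp add: n\<nu> \<nu>)
    have gB: "norm g \<le> B"
    proof -
      have "(norm g)\<^sup>2 = (norm (G (Y x)))\<^sup>2 - (G (Y x) \<bullet> \<nu>)\<^sup>2"
        unfolding g_def power2_norm_eq_inner
        by (simp add: inner_diff_left inner_diff_right \<nu>\<nu> inner_commute power2_eq_square algebra_simps)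
      then have "(norm g)\<^sup>2 \<le> (norm (G (Y x)))\<^sup>2" by simp
      then have "norm g \<le> norm (G (Y x))" by (rule power2_le_imp_le) simp
      with GB[OF YxD] show ?thesis by simp
    qed
    have nB: "norm n \<le> 1 + B" using norm_triangle_ineq4[of \<nu> g] gB \<nu> by (simp add: n_def)
    define c where "c = q + \<rho> *\<^sub>R n"
    have in_ball: "z \<in> ball c (\<rho> * norm n) \<longleftrightarrow> (norm (z - q))\<^sup>2 < 2 * \<rho> * (n \<bullet> (z - q))" for z
    proof -
      have "z \<in> ball c (\<rho> * norm n) \<longleftrightarrow> norm (\<rho> *\<^sub>R n - (z - q)) < norm (\<rho> *\<^sub>R n)"
        using \<rho>0 by (simp add: c_def dist_norm algebra_simps)
      also have "\<dots> \<longleftrightarrow> (norm (\<rho> *\<^sub>R n - (z - q)))\<^sup>2 < (norm (\<rho> *\<^sub>R n))\<^sup>2"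
        unfolding norm_lt power2_norm_eq_inner ..
      also have "(norm (\<rho> *\<^sub>R n - (z - q)))\<^sup>2 = (norm (\<rho> *\<^sub>R n))\<^sup>2 - 2 * \<rho> * (n \<bullet> (z - q)) + (norm (z - q))\<^sup>2"
        unfolding power2_norm_eq_inner
        by (simp only: inner_diff_left[of "\<rho> *\<^sub>R n"] inner_diff_right[of _ "\<rho> *\<^sub>R n"])
          (simp add: inner_commute)
      finally show ?thesis by auto
    qed
    \<comment> \<open>As \<open>x - q = s *\<^sub>R \<nu>\<close> and
      \<open>n \<bullet> \<nu> = 1\<close>, the criterion reads
      \<open>s\<^sup>2 < 2 * \<rho> * s\<close>.\<close>
    have "x \<in> ball c (\<rho> * norm n)"
      unfolding in_ball using s n\<nu> \<nu> by (simp add: q_def power2_eq_square)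
    moreover have "z \<notin> \<Omega>" if z: "z \<in> ball c (\<rho> * norm n)" for z
    proof -
      have zq: "norm (z - q) < 2 * \<rho> * (1 + B)"
      proof -
        have "norm (z - q) \<le> norm (c - z) + norm (c - q)"
          using norm_triangle_ineq4[of "c - q" "c - z"] by simp
        also have "\<dots> < \<rho> * norm n + \<rho> * norm n" using z \<rho>0 by (simp add: c_def dist_norm)
        also have "\<dots> \<le> 2 * \<rho> * (1 + B)" using nB \<rho>0 by simp
        finally show ?thesis .
      qed
      have "q - p = Y x + \<gamma> (Y x) *\<^sub>R \<nu>" by (simp add: q_def s_def Y_def algebra_simps)
      then have "norm (q - p) \<le> norm (Y x) + \<bar>\<gamma> (Y x)\<bar>"
        using norm_triangle_ineq[of "Y x" "\<gamma> (Y x) *\<^sub>R \<nu>"] \<nu> by simp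
      also have "\<dots> \<le> (1 + B) * norm (x - p)"
        using \<gamma>x Y_le[of x p] by (simp add: Yp algebra_simps)
      also have "\<dots> \<le> (1 + B) * r'" using xp B0 by (intro mult_left_mono) auto
      finally have "norm (q - p) \<le> \<rho>" using r'(3) by simp
      then have "norm (z - p) < 2 * \<rho> * (1 + B) + \<rho>"
        using zq norm_triangle_ineq[of "z - q" "q - p"] by simp
      also have "\<dots> \<le> m" using \<rho>m \<rho>m' m by linarith
      finally have zm: "z \<in> ball p m" by (simp add: dist_norm norm_minus_commute)
      have YqYx: "Y q = Y x" "T q = \<gamma> (Y x)"
        by (simp_all add: q_def Y_def T_def s_def inner_diff_left \<nu>\<nu> algebra_simps)
      have Yzx: "norm (Y z - Y x) \<le> norm (z - q)" using Y_le[of z q] YqYx by simp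
      \<comment> \<open>This is the height of \<open>z\<close> above the tangent plane at
        \<open>q\<close>. In the ball, \<open>2 * \<rho>\<close> times it exceeds the squared
        distance to \<open>q\<close>, which by the choice of \<rho> is at least
        \<open>2 * \<rho>\<close> times the Taylor error; so \<open>z\<close> is above the
        graph.\<close>
      have "n \<bullet> (z - q) = (T z - \<gamma> (Y x)) - G (Y x) \<bullet> (Y z - Y x)"
      proof -
        have "g \<bullet> (z - q) = G (Y x) \<bullet> (Y z - Y q)"
          unfolding YY by (simp add: g_def inner_diff_left inner_diff_right inner_commute algebra_simps)
        moreover have "\<nu> \<bullet> (z - q) = T z - T q" by (simp add: T_def inner_diff_left inner_diff_right inner_commute)
        ultimately show ?thesis by (simp add: n_def inner_diff_left YqYx)
      qed
      then have 1: "(norm (z - q))\<^sup>2 < 2 * \<rho> * ((T z - \<gamma> (Y x)) - G (Y x) \<bullet> (Y z - Y x))"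
        using z unfolding in_ball by simp
      have "\<gamma> (Y z) - \<gamma> (Y x) - G (Y x) \<bullet> (Y z - Y x) \<le> L * (norm (Y z - Y x) * norm (Y z - Y x))"
        using taylor[OF YxD Y_in[OF zm]] by simp
      also have "\<dots> \<le> L * (norm (z - q))\<^sup>2"
        unfolding power2_eq_square using L0 Yzx by (intro mult_left_mono mult_mono) auto
      finally have "2 * \<rho> * (\<gamma> (Y z) - \<gamma> (Y x) - G (Y x) \<bullet> (Y z - Y x)) \<le> 2 * \<rho> * (L * (norm (z - q))\<^sup>2)"
        using \<rho>0 by (intro mult_left_mono) auto
      also have "\<dots> \<le> 1 * (norm (z - q))\<^sup>2"
        using mult_right_mono[OF \<rho>L, of "(norm (z - q))\<^sup>2"] by (simp add: mult_ac)
      finally have "2 * \<rho> * (\<gamma> (Y z) - \<gamma> (Y x) - G (Y x) \<bullet> (Y z - Y x))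
          < 2 * \<rho> * ((T z - \<gamma> (Y x)) - G (Y x) \<bullet> (Y z - Y x))"
        using 1 by linarith
      then have "\<gamma> (Y z) < T z" using \<rho>0 by simp
      then show ?thesis using graph_in[OF zm] by simp
    qed
    moreover have "\<rho> \<le> \<rho> * norm n" using n1 \<rho>0 by simp
    ultimately show ?thesis by blast
  qed
  have "exterior_ball_at \<Omega> p"
    unfolding exterior_ball_at_def using ball r'(1) \<rho>0 by blast
  with cone show ?thesis by blast
qed

section \<open>Volume of thin layers outside the domain\<close>

definition outer_layer :: "'a::euclidean_space set \<Rightarrow> real \<Rightarrow> 'a set" where
  "outer_layer \<Omega> \<tau> = {x. x \<notin> \<Omega> \<and> infdist x \<Omega> \<le> \<tau>}"

lemma outer_layer_borel:
  assumes "open \<Omega>"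
  shows "outer_layer \<Omega> \<tau> \<in> sets borel"
proof -
  have "closed {x. infdist x \<Omega> \<le> \<tau>}"
    by (intro closed_Collect_le continuous_intros)
  moreover have "outer_layer \<Omega> \<tau> = - \<Omega> \<inter> {x. infdist x \<Omega> \<le> \<tau>}"
    by (auto simp: outer_layer_def)
  ultimately show ?thesis using assms by (auto intro: borel_closed)
qed

lemma outer_layer_Int_ball_lmeasurable:
  assumes "open \<Omega>"
  shows "outer_layer \<Omega> \<tau> \<inter> ball q \<rho> \<in> lmeasurable"
  using fmeasurable_Int_fmeasurable[OF lmeasurable_ball, of "outer_layer \<Omega> \<tau>" q \<rho>]
    outer_layer_borel[OF assms, of \<tau>] by (simp add: Int_commute sets_completionI_sets)

lemma infdist_lessE:
  assumes "infdist x A < e" "A \<noteq> {}"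
  obtains y where "y \<in> A" "dist x y < e"
proof -
  have "(INF y\<in>A. dist x y) < e" using assms by (simp add: infdist_def)
  then show thesis using that assms(2) by (subst (asm) cINF_less_iff) auto
qed

text \<open>Translates of the layer along the axis of the exterior cone, by multiples of a step comparable
  to its thickness, are disjoint, so many of them have to fit into a ball.\<close>

lemma outer_layer_volume_at:
  fixes \<Omega> :: "'a::euclidean_space set"
  assumes "open \<Omega>" "\<Omega> \<noteq> {}" "exterior_cone_at \<Omega> p"
  obtains r C c where "0 < r" "0 < C" "0 < c"
    "\<And>q \<rho> \<tau>. \<lbrakk>ball q \<rho> \<subseteq> ball p r; 0 < \<rho>; 0 < \<tau>; \<tau> \<le> c * \<rho>\<rbrakk> \<Longrightarrow>
       measure lebesgue (outer_layer \<Omega> \<tau> \<inter> ball q \<rho>) \<le> C * \<rho> ^ (DIM('a) - 1) * \<tau>"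
proof -
  obtain r \<kappa> \<nu> where r: "0 < r" and \<kappa>: "0 < \<kappa>" and \<nu>: "norm \<nu> = 1"
    and cone: "\<And>x s w. \<lbrakk>x \<in> ball p r; x \<notin> \<Omega>; 0 < s; s < r; norm w \<le> \<kappa> * s\<rbrakk> \<Longrightarrow> x + s *\<^sub>R \<nu> + w \<notin> \<Omega>"
    using assms(3) unfolding exterior_cone_at_def by blast
  let ?d = "DIM('a)"
  define \<omega> where "\<omega> = unit_ball_vol (real ?d)"
  have \<omega>: "0 < \<omega>" by (simp add: \<omega>_def)
  have bound: "measure lebesgue (outer_layer \<Omega> \<tau> \<inter> ball q \<rho>) \<le> (\<omega> * 2 ^ ?d * 4 / \<kappa>) * \<rho> ^ (?d - 1) * \<tau>"
    if sub: "ball q \<rho> \<subseteq> ball p r" and \<rho>: "0 < \<rho>" and \<tau>: "0 < \<tau>" "\<tau> \<le> \<kappa> / 2 * \<rho>" for q \<rho> \<tau>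
  proof -
    let ?A = "outer_layer \<Omega> \<tau> \<inter> ball q \<rho>"
    have A: "?A \<in> lmeasurable" using assms(1) by (rule outer_layer_Int_ball_lmeasurable)
    have \<rho>r: "\<rho> \<le> r" 
    proof -
      have "dist q p + \<rho> \<le> r" using sub \<rho> by (simp add: ball_subset_ball_iff)
      then show ?thesis using zero_le_dist[of q p] by linarith
    qed
    \<comment> \<open>After even one step \<sigma> along the axis, the cone contains a ball of
      radius \<open>2 * \<tau>\<close> disjoint from \<Omega>, so the translated point has left the
      layer.\<close>
    define \<sigma> where "\<sigma> = 2 * \<tau> / \<kappa>"
    have \<sigma>: "0 < \<sigma>" "\<sigma> \<le> \<rho>" "\<kappa> * \<sigma> = 2 * \<tau>" using \<tau> \<kappa> by (auto simp: \<sigma>_def field_simps)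
    \<comment> \<open>The floor is at least 1 because \<sigma> is at most \<rho>; rounding down
      therefore loses at most a factor 2.\<close>
    define n where "n = nat \<lfloor>\<rho> / \<sigma>\<rfloor>"
    have fl: "1 \<le> \<lfloor>\<rho> / \<sigma>\<rfloor>" using \<sigma> by (simp add: le_floor_iff)
    have n: "real n \<le> \<rho> / \<sigma>" "\<rho> / \<sigma> \<le> 2 * real n"
    proof -
      have "real n = of_int \<lfloor>\<rho> / \<sigma>\<rfloor>" using fl by (simp add: n_def)
      moreover have "\<rho> / \<sigma> < of_int \<lfloor>\<rho> / \<sigma>\<rfloor> + 1" by linarith
      moreover have "1 \<le> real_of_int \<lfloor>\<rho> / \<sigma>\<rfloor>" using fl by linarith
      ultimately show "real n \<le> \<rho> / \<sigma>" "\<rho> / \<sigma> \<le> 2 * real n" by linarith+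
    qed
    have n\<sigma>: "real n * \<sigma> \<le> \<rho>" using n(1) \<sigma>(1) by (simp add: field_simps)
    let ?T = "\<lambda>k::nat. (+) ((real k * \<sigma>) *\<^sub>R \<nu>) ` ?A"
    have key: "x + (real j * \<sigma>) *\<^sub>R \<nu> \<notin> ?A" if x: "x \<in> ?A" and j: "0 < j" "j < n" for x j
    proof
      assume "x + (real j * \<sigma>) *\<^sub>R \<nu> \<in> ?A"
      then have "infdist (x + (real j * \<sigma>) *\<^sub>R \<nu>) \<Omega> < 2 * \<tau>"
        using \<tau>(1) by (simp add: outer_layer_def)
      then obtain y where y: "y \<in> \<Omega>" "dist (x + (real j * \<sigma>) *\<^sub>R \<nu>) y < 2 * \<tau>"
        using infdist_lessE assms(2) by blast
      let ?w = "y - (x + (real j * \<sigma>) *\<^sub>R \<nu>)"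
      have "real j * \<sigma> < real n * \<sigma>" using j \<sigma> by simp
      then have jr: "real j * \<sigma> < r" using n\<sigma> \<rho>r by linarith
      have "1 * \<sigma> \<le> real j * \<sigma>" using j \<sigma> by (intro mult_right_mono) auto
      then have "\<kappa> * \<sigma> \<le> \<kappa> * (real j * \<sigma>)" using \<kappa> by simp
      then have w: "norm ?w \<le> \<kappa> * (real j * \<sigma>)"
        using y(2) \<sigma>(3) by (simp add: dist_norm norm_minus_commute)
      have "x \<in> ball p r" "x \<notin> \<Omega>" using x sub by (auto simp: outer_layer_def)
      from cone[OF this _ jr w] j \<sigma> y(1) show False by simp
    qed
    have disj: "disjoint_family_on ?T {..<n}"
    proof -
      have *: "?T k \<inter> ?T l = {}" if "k < l" "l < n" for k l
      proof (rule ccontr)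
        assume "?T k \<inter> ?T l \<noteq> {}"
        then obtain x y where xy: "x \<in> ?A" "y \<in> ?A"
          and eq: "(real k * \<sigma>) *\<^sub>R \<nu> + x = (real l * \<sigma>) *\<^sub>R \<nu> + y" by blast
        have "real (l - k) = real l - real k" using that by simp
        then have "x = y + (real (l - k) * \<sigma>) *\<^sub>R \<nu>"
          using eq by (simp add: algebra_simps)
        moreover have "0 < l - k" "l - k < n" using that by auto
        ultimately show False using key[OF xy(2)] xy(1) by metis
      qed
      show ?thesis unfolding disjoint_family_on_def
        using * by (metis Int_commute lessThan_iff linorder_neqE_nat)
    qed
    have T: "?T k \<in> lmeasurable" for k using A by (rule measurable_translation)
    have sub2: "(\<Union>k<n. ?T k) \<subseteq> ball q (2 * \<rho>)"
    proof
      fix y assume "y \<in> (\<Union>k<n. ?T k)"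
      then obtain k x where k: "k < n" and x: "x \<in> ball q \<rho>" and y: "y = (real k * \<sigma>) *\<^sub>R \<nu> + x"
        by blast
      have "real k * \<sigma> \<le> real n * \<sigma>" using k \<sigma> by (intro mult_right_mono) auto
      then have "real k * \<sigma> \<le> \<rho>" using n\<sigma> by linarith
      then have "norm ((real k * \<sigma>) *\<^sub>R \<nu>) \<le> \<rho>" using \<nu> \<sigma> by simp
      then have "norm (x - q + (real k * \<sigma>) *\<^sub>R \<nu>) < 2 * \<rho>"
        using x norm_triangle_ineq[of "x - q" "(real k * \<sigma>) *\<^sub>R \<nu>"]
        by (simp add: dist_norm norm_minus_commute)
      then show "y \<in> ball q (2 * \<rho>)"
        unfolding y by (metis add.commute add_diff_eq dist_commute dist_norm mem_ball)
    qed
    have "real n * measure lebesgue ?A = (\<Sum>k<n. measure lebesgue (?T k))"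
      by (simp add: measure_translation)
    also have "\<dots> = measure lebesgue (\<Union>k<n. ?T k)"
      using disj fmeasurableD[OF T] fmeasurableD2[OF T]
      by (intro measure_finite_Union[symmetric]) (auto simp del: emeasure_completion)
    also have "\<dots> \<le> measure lebesgue (ball q (2 * \<rho>))"
      using sub2 fmeasurableD[OF T] by (intro measure_mono_fmeasurable) auto
    also have "\<dots> = \<omega> * (2 * \<rho>) ^ ?d"
      using content_ball[of "2 * \<rho>" q] \<rho> by (simp add: \<omega>_def measure_completion)
    finally have vol: "real n * measure lebesgue ?A \<le> \<omega> * (2 * \<rho>) ^ ?d" .
    \<comment> \<open>Now \<open>\<rho> \<le> 2 * n * \<sigma>\<close> turns the packing bound into
      one linear in \<sigma>, hence in \<tau>; a factor \<rho> is kept on both sides and cancelled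
      at the end.\<close>
    have "\<rho> * measure lebesgue ?A \<le> (2 * real n * \<sigma>) * measure lebesgue ?A"
      using n(2) \<sigma>(1) by (intro mult_right_mono) (auto simp: field_simps)
    also have "\<dots> \<le> 2 * \<sigma> * (\<omega> * (2 * \<rho>) ^ ?d)"
      using mult_left_mono[OF vol, of "2 * \<sigma>"] \<sigma>(1) by (simp add: mult_ac)
    also have "\<dots> = \<rho> * ((\<omega> * 2 ^ ?d * 4 / \<kappa>) * \<rho> ^ (?d - 1) * \<tau>)"
    proof -
      have "\<rho> ^ ?d = \<rho> * \<rho> ^ (?d - 1)" by (subst power_eq_if) simp
      then show ?thesis by (simp add: \<sigma>_def power_mult_distrib)
    qed
    finally show ?thesis by (rule mult_left_le_imp_le) (rule \<rho>)
  qed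
  show thesis
    using that[of r "\<omega> * 2 ^ ?d * 4 / \<kappa>" "\<kappa> / 2"] bound r \<kappa> \<omega> by simp
qed

text \<open>Compactness of the frontier makes the local constants uniform: finitely many base points
  suffice, and a Lebesgue number of their cover serves as the largest radius.\<close>

lemma outer_layer_volume:
  fixes \<Omega> :: "'a::euclidean_space set"
  assumes "open \<Omega>" "\<Omega> \<noteq> {}" "bounded \<Omega>" "\<And>p. p \<in> frontier \<Omega> \<Longrightarrow> exterior_cone_at \<Omega> p"
  obtains \<rho>\<^sub>0 C c where "0 < \<rho>\<^sub>0" "0 < C" "0 < c"
    "\<And>q \<rho> \<tau>. \<lbrakk>q \<in> frontier \<Omega>; 0 < \<rho>; \<rho> \<le> \<rho>\<^sub>0; 0 < \<tau>; \<tau> \<le> c * \<rho>\<rbrakk> \<Longrightarrow>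
       measure lebesgue (outer_layer \<Omega> \<tau> \<inter> ball q \<rho>) \<le> C * \<rho> ^ (DIM('a) - 1) * \<tau>"
proof -
  have "\<exists>r C c. 0 < r \<and> 0 < C \<and> 0 < c \<and> (\<forall>q \<rho> \<tau>. ball q \<rho> \<subseteq> ball p r \<longrightarrow> 0 < \<rho> \<longrightarrow> 0 < \<tau> \<longrightarrow> \<tau> \<le> c * \<rho> \<longrightarrow>
       measure lebesgue (outer_layer \<Omega> \<tau> \<inter> ball q \<rho>) \<le> C * \<rho> ^ (DIM('a) - 1) * \<tau>)"
    if "p \<in> frontier \<Omega>" for p
    using outer_layer_volume_at[OF assms(1,2) assms(4)[OF that]] by metis
  then obtain r C c where *: "\<And>p. p \<in> frontier \<Omega> \<Longrightarrow> 0 < r p \<and> 0 < C p \<and> 0 < c p \<and>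
      (\<forall>q \<rho> \<tau>. ball q \<rho> \<subseteq> ball p (r p) \<longrightarrow> 0 < \<rho> \<longrightarrow> 0 < \<tau> \<longrightarrow> \<tau> \<le> c p * \<rho> \<longrightarrow>
       measure lebesgue (outer_layer \<Omega> \<tau> \<inter> ball q \<rho>) \<le> C p * \<rho> ^ (DIM('a) - 1) * \<tau>)"
    by metis
  have comp: "compact (frontier \<Omega>)" using assms(3) by (simp add: compact_frontier_bounded)
  obtain P where P: "P \<subseteq> frontier \<Omega>" "finite P" "frontier \<Omega> \<subseteq> (\<Union>p\<in>P. ball p (r p))"
    by (rule compactE_image[OF comp, of "frontier \<Omega>" "\<lambda>p. ball p (r p)"]) (use * in auto)
  obtain e where e: "0 < e" "\<And>q. q \<in> frontier \<Omega> \<Longrightarrow> \<exists>p\<in>P. ball q e \<subseteq> ball p (r p)"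
    by (rule Heine_Borel_lemma[OF comp, of "(\<lambda>p. ball p (r p)) ` P"]) (use P in auto)
  \<comment> \<open>The added 1 here and the inserted 1 in the minimum below give positive constants
    even for empty \<open>P\<close>.\<close>
  define C' where "C' = 1 + (\<Sum>p\<in>P. C p)"
  define c' where "c' = Min (insert 1 (c ` P))"
  have C': "0 < C'" "\<And>p. p \<in> P \<Longrightarrow> C p \<le> C'"
  proof -
    have nn: "0 \<le> C p" if "p \<in> P" for p using * P(1) that by (meson less_imp_le subsetD)
    show "0 < C'" using nn by (simp add: C'_def sum_nonneg add_pos_nonneg)
    show "C p \<le> C'" if "p \<in> P" for p
      using member_le_sum[of p P C] nn P(2) that by (auto simp: C'_def)
  qed
  have c': "0 < c'" "\<And>p. p \<in> P \<Longrightarrow> c' \<le> c p"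
    using * P by (auto simp: c'_def)
  show thesis
  proof (rule that[OF e(1) C'(1) c'(1)])
    fix q \<rho> \<tau> assume q: "q \<in> frontier \<Omega>" "0 < \<rho>" "\<rho> \<le> e" "0 < \<tau>" "\<tau> \<le> c' * \<rho>"
    obtain p where p: "p \<in> P" "ball q e \<subseteq> ball p (r p)" using e(2) q(1) by blast
    have 1: "ball q \<rho> \<subseteq> ball p (r p)" using p(2) q(3) by (meson order_trans subset_ball)
    have "\<tau> \<le> c p * \<rho>" using q c'(2)[OF p(1)] by (meson less_imp_le mult_right_mono order_trans)
    then have "measure lebesgue (outer_layer \<Omega> \<tau> \<inter> ball q \<rho>) \<le> C p * \<rho> ^ (DIM('a) - 1) * \<tau>"
      using * P(1) p(1) q(2,4) 1 by (meson subsetD)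
    also have "\<dots> \<le> C' * \<rho> ^ (DIM('a) - 1) * \<tau>"
      using C'(2)[OF p(1)] q by (intro mult_right_mono) auto
    finally show "measure lebesgue (outer_layer \<Omega> \<tau> \<inter> ball q \<rho>) \<le> C' * \<rho> ^ (DIM('a) - 1) * \<tau>" .
  qed
qed

text \<open>The frontier lies in every outer layer, and the volume of the layer in a fixed small
  ball is of order \<tau>. Let \<tau> tend to 0 and cover by finitely many such balls.\<close>

lemma exterior_cone_negligible_frontier:
  fixes \<Omega> :: "'a::euclidean_space set"
  assumes "open \<Omega>" "\<Omega> \<noteq> {}" "bounded \<Omega>" "\<And>p. p \<in> frontier \<Omega> \<Longrightarrow> exterior_cone_at \<Omega> p"
  shows "negligible (frontier \<Omega>)"
proof -
  obtain \<rho> C c where C: "0 < \<rho>" "0 < C" "0 < c"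
    and vol: "\<And>q r \<tau>. \<lbrakk>q \<in> frontier \<Omega>; 0 < r; r \<le> \<rho>; 0 < \<tau>; \<tau> \<le> c * r\<rbrakk> \<Longrightarrow>
       measure lebesgue (outer_layer \<Omega> \<tau> \<inter> ball q r) \<le> C * r ^ (DIM('a) - 1) * \<tau>"
    using outer_layer_volume[OF assms] by metis
  have comp: "compact (frontier \<Omega>)" using assms(3) by (simp add: compact_frontier_bounded)
  have sub: "frontier \<Omega> \<subseteq> outer_layer \<Omega> \<tau>" if "0 < \<tau>" for \<tau>
  proof
    fix x assume x: "x \<in> frontier \<Omega>"
    then have "infdist x \<Omega> = 0" using assms(2) by (simp add: frontier_def in_closure_iff_infdist_zero)
    with x that assms(1) show "x \<in> outer_layer \<Omega> \<tau>" by (auto simp: outer_layer_def frontier_def interior_open)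
  qed
  have meas: "frontier \<Omega> \<inter> ball q \<rho> \<in> lmeasurable" for q
    using lmeasurable_compact[OF comp] lmeasurable_ball by (rule fmeasurable.Int)
  have "negligible (frontier \<Omega> \<inter> ball q \<rho>)" if q: "q \<in> frontier \<Omega>" for q
  proof -
    let ?a = "measure lebesgue (frontier \<Omega> \<inter> ball q \<rho>)"
    have le: "?a \<le> C * \<rho> ^ (DIM('a) - 1) * \<tau>" if \<tau>: "0 < \<tau>" "\<tau> \<le> c * \<rho>" for \<tau>
    proof -
      have "?a \<le> measure lebesgue (outer_layer \<Omega> \<tau> \<inter> ball q \<rho>)"
        using sub[OF \<tau>(1)]
        by (intro measure_mono_fmeasurable[OF _ fmeasurableD[OF meas] outer_layer_Int_ball_lmeasurable[OF assms(1)]])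
          blast
      also have "\<dots> \<le> C * \<rho> ^ (DIM('a) - 1) * \<tau>" using vol q C \<tau> by simp
      finally show ?thesis .
    qed
    have "?a \<le> 0"
    proof (rule tendsto_lowerbound)
      show "((\<lambda>\<tau>. C * \<rho> ^ (DIM('a) - 1) * \<tau>) \<longlongrightarrow> 0) (at_right 0)"
        by (auto intro!: tendsto_eq_intros)
      show "\<forall>\<^sub>F \<tau> in at_right 0. ?a \<le> C * \<rho> ^ (DIM('a) - 1) * \<tau>"
        using le C by (auto simp: eventually_at_right_field intro!: exI[of _ "c * \<rho>"])
    qed simp
    then have "?a = 0" using measure_nonneg[of lebesgue "frontier \<Omega> \<inter> ball q \<rho>"] by linarith
    then show ?thesis using meas negligible_iff_measure by blast
  qed
  moreover obtain P where P: "P \<subseteq> frontier \<Omega>" "finite P" "frontier \<Omega> \<subseteq> (\<Union>p\<in>P. ball p \<rho>)"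
    by (rule compactE_image[OF comp, of "frontier \<Omega>" "\<lambda>p. ball p \<rho>"]) (use C in auto)
  ultimately have "negligible (\<Union>p\<in>P. frontier \<Omega> \<inter> ball p \<rho>)"
    by (intro negligible_Union) auto
  then show ?thesis by (rule negligible_subset) (use P in auto)
qed

subsection \<open>Truncation by the domain\<close>

text \<open>Balls are removed one at a time. Each costs only the volume that the earlier ones left
  over, so the costs add up to the volume of \<open>F\<close> in the union.\<close>

lemma perimeter_Diff_Union_balls_le:
  fixes F :: "'a::euclidean_space set" and B :: "nat \<Rightarrow> 'a set"
  assumes F: "F \<in> lmeasurable" and R: "0 < R" and p: "perimeter F \<le> ennreal p" "0 \<le> p"
    and B: "\<And>n. B n = {} \<or> (\<exists>c R'. R \<le> R' \<and> B n = ball c R')"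
  shows "perimeter (F - (\<Union>k<n. B k)) \<le> ennreal (p + DIM('a) / R * measure lebesgue (F \<inter> (\<Union>k<n. B k)))"
proof (induction n)
  case 0
  then show ?case using p by simp
next
  case (Suc n)
  let ?U = "\<Union>k<n. B k"
  let ?\<mu> = "measure lebesgue (F \<inter> ?U)"
  have openB: "open (B k)" for k using B[of k] by auto
  then have openU: "open ?U" by blast
  have m1: "F - ?U \<in> lmeasurable" "F \<inter> ?U \<in> lmeasurable" "(F - ?U) \<inter> B n \<in> lmeasurable"
    using F openU openB by (auto intro!: fmeasurable_Int_fmeasurable fmeasurable_Diff)
  have "F \<inter> (\<Union>k<Suc n. B k) = (F \<inter> ?U) \<union> ((F - ?U) \<inter> B n)"
    by (auto simp: lessThan_Suc)
  then have \<mu>: "measure lebesgue (F \<inter> (\<Union>k<Suc n. B k)) = ?\<mu> + measure lebesgue ((F - ?U) \<inter> B n)"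
    using measure_Un3[OF m1(2,3)] by (simp add: Int_ac Diff_Int_distrib)
  have D: "F - (\<Union>k<Suc n. B k) = (F - ?U) - B n" by (auto simp: lessThan_Suc)
  show ?case
  proof (cases "B n = {}")
    case True
    with Suc show ?thesis by (simp add: lessThan_Suc)
  next
    case False
    then obtain c R' where R': "R \<le> R'" and Bn: "B n = ball c R'" using B by blast
    have "perimeter ((F - ?U) - ball c R')
        \<le> ennreal (p + DIM('a) / R * ?\<mu> + DIM('a) / R' * measure lebesgue ((F - ?U) \<inter> ball c R'))"
      using m1 Suc p R R' by (intro perimeter_Diff_ball_le) auto
    also have "\<dots> \<le> ennreal (p + DIM('a) / R * ?\<mu> + DIM('a) / R * measure lebesgue ((F - ?U) \<inter> ball c R'))"
      using R R' by (intro ennreal_leI add_left_mono mult_right_mono divide_left_mono) auto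
    finally show ?thesis unfolding D \<mu> Bn by (simp add: algebra_simps)
  qed
qed

text \<open>Up to the null frontier, \<open>F - \<Omega>\<close> is covered by countably many
  exterior balls. Removing finitely many keeps the perimeter under one common bound, which passes to
  the limit by lower semicontinuity.\<close>

lemma perimeter_Int_le:
  fixes \<Omega> :: "'a::euclidean_space set"
  assumes "open \<Omega>" "bounded \<Omega>" "\<Omega> \<noteq> {}" "negligible (frontier \<Omega>)"
    and eb: "\<And>p. p \<in> frontier \<Omega> \<Longrightarrow> exterior_ball_at \<Omega> p"
  obtains \<delta> R where "0 < \<delta>" "0 < R"
    "\<And>F p. \<lbrakk>F \<in> lmeasurable; \<And>x. x \<in> F \<Longrightarrow> infdist x \<Omega> < \<delta>; perimeter F \<le> ennreal p; 0 \<le> p\<rbrakk> \<Longrightarrow>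
       perimeter (F \<inter> \<Omega>) \<le> ennreal (p + DIM('a) / R * measure lebesgue (F - \<Omega>))"
proof -
  let ?Q = "\<lambda>p r R. p \<in> frontier \<Omega> \<longrightarrow> 0 < r \<and> 0 < R \<and> (\<forall>x \<in> ball p r - closure \<Omega>.
     \<exists>c R'. R \<le> R' \<and> x \<in> ball c R' \<and> ball c R' \<inter> \<Omega> = {})"
  have "\<forall>p. \<exists>r R. ?Q p r R"
    using eb unfolding exterior_ball_at_def by blast
  from choice[OF this] obtain r where "\<forall>p. \<exists>R. ?Q p (r p) R" ..
  from choice[OF this] obtain R where "\<forall>p. ?Q p (r p) (R p)" ..
  then have *: "p \<in> frontier \<Omega> \<Longrightarrow> 0 < r p \<and> 0 < R p \<and> (\<forall>x \<in> ball p (r p) - closure \<Omega>.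
     \<exists>c R'. R p \<le> R' \<and> x \<in> ball c R' \<and> ball c R' \<inter> \<Omega> = {})" for p
    by blast
  have comp: "compact (frontier \<Omega>)" using assms(2) by (simp add: compact_frontier_bounded)
  obtain P where P: "P \<subseteq> frontier \<Omega>" "finite P" "frontier \<Omega> \<subseteq> (\<Union>p\<in>P. ball p (r p))"
    by (rule compactE_image[OF comp, of "frontier \<Omega>" "\<lambda>p. ball p (r p)"]) (use * in auto)
  obtain e where e: "0 < e" "\<And>q. q \<in> frontier \<Omega> \<Longrightarrow> \<exists>p\<in>P. ball q e \<subseteq> ball p (r p)"
    by (rule Heine_Borel_lemma[OF comp, of "(\<lambda>p. ball p (r p)) ` P"]) (use P in auto)
  define R0 where "R0 = Min (insert 1 (R ` P))"
  have R0: "0 < R0" "\<And>p. p \<in> P \<Longrightarrow> R0 \<le> R p" using * P by (auto simp: R0_def)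
  define \<G> where "\<G> = {ball c R' |c R'. R0 \<le> R' \<and> ball c R' \<inter> \<Omega> = {}}"
  \<comment> \<open>The segment from \<open>x\<close> to a close point of \<Omega> meets the
    frontier at some \<open>y\<close> nearer than \<open>e\<close>, and \<open>ball y e\<close> lies
    in one of the finitely many chosen balls.\<close>
  have cover: "x \<in> \<Union>\<G>" if x: "x \<notin> closure \<Omega>" "infdist x \<Omega> < e" for x
  proof -
    obtain z where z: "z \<in> \<Omega>" "dist x z < e"
      using infdist_lessE[OF x(2) assms(3)] by blast
    have "closed_segment x z \<inter> frontier \<Omega> \<noteq> {}"
      using x(1) z(1) closure_subset
      by (intro connected_Int_frontier) auto
    then obtain y where y: "y \<in> closed_segment x z" "y \<in> frontier \<Omega>" by blast
    have "x \<in> ball y e" using segment_bound(1)[OF y(1)] z(2) by (simp add: dist_norm norm_minus_commute)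
    then obtain p where p: "p \<in> P" "x \<in> ball p (r p)" using e(2)[OF y(2)] by blast
    moreover have "p \<in> frontier \<Omega>" using p(1) P(1) by blast
    ultimately obtain c R' where "R p \<le> R'" "x \<in> ball c R'" "ball c R' \<inter> \<Omega> = {}"
      using *[of p] x(1) by (metis DiffI)
    moreover from this R0(2)[OF p(1)] have "ball c R' \<in> \<G>" unfolding \<G>_def by fastforce
    ultimately show ?thesis by blast
  qed
  obtain \<G>' where \<G>': "\<G>' \<subseteq> \<G>" "countable \<G>'" "\<Union>\<G>' = \<Union>\<G>"
    by (rule Lindelof[of \<G>]) (auto simp: \<G>_def)
  \<comment> \<open>Adding the empty set allows an enumeration by the natural numbers also when the
    family is empty.\<close>
  define B where "B = from_nat_into (insert {} \<G>')"
  have rangeB: "range B = insert {} \<G>'"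
    unfolding B_def using \<G>'(2) by (intro range_from_nat_into) auto
  have B: "B n = {} \<or> (\<exists>c R'. R0 \<le> R' \<and> B n = ball c R')" and B\<Omega>: "B n \<inter> \<Omega> = {}" and openB: "open (B n)" for n
  proof -
    have "B n \<in> insert {} \<G>'" using rangeB by blast
    then have "B n = {} \<or> B n \<in> \<G>" using \<G>'(1) by blast
    then have *: "B n = {} \<or> (\<exists>c R'. R0 \<le> R' \<and> ball c R' \<inter> \<Omega> = {} \<and> B n = ball c R')"
      unfolding \<G>_def by blast
    then show "B n = {} \<or> (\<exists>c R'. R0 \<le> R' \<and> B n = ball c R')" by blast
    show "B n \<inter> \<Omega> = {}" using * by auto
    show "open (B n)" using * by auto
  qed
  show thesis
  proof (rule that[OF e(1) R0(1)])
    fix F :: "'a set" and p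
    assume F: "F \<in> lmeasurable" "\<And>x. x \<in> F \<Longrightarrow> infdist x \<Omega> < e" and p: "perimeter F \<le> ennreal p" "0 \<le> p"
    let ?A = "\<lambda>n. F - (\<Union>k<n. B k)"
    have FO: "F - \<Omega> \<in> lmeasurable" "F \<inter> \<Omega> \<in> lmeasurable"
      using fmeasurable_Diff[OF F(1), of \<Omega>] fmeasurable_Int_fmeasurable[OF F(1), of \<Omega>] assms(1) by simp_all
    show "perimeter (F \<inter> \<Omega>) \<le> ennreal (p + DIM('a) / R0 * measure lebesgue (F - \<Omega>))"
    proof (rule perimeter_lower_semicontinuous[OF F(1)])
      have U: "(\<Union>k<n. B k) \<in> sets lebesgue" for n
        by (intro sets_completionI_sets) (simp add: openB open_UN borel_open)
      show "?A n \<in> sets lebesgue" for n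
        using fmeasurableD[OF F(1)] U by (rule sets.Diff)
      show "?A n \<subseteq> F" for n by blast
      show "F \<inter> \<Omega> \<in> sets lebesgue" using FO(2) by (rule fmeasurableD)
      show "0 \<le> p + DIM('a) / R0 * measure lebesgue (F - \<Omega>)" using p R0 by simp
      show "perimeter (?A n) \<le> ennreal (p + DIM('a) / R0 * measure lebesgue (F - \<Omega>))" for n
      proof -
        have "F \<inter> (\<Union>k<n. B k) \<in> lmeasurable"
          using F(1) U by (rule fmeasurable_Int_fmeasurable)
        then have "measure lebesgue (F \<inter> (\<Union>k<n. B k)) \<le> measure lebesgue (F - \<Omega>)"
          using FO(1) B\<Omega> by (intro measure_mono_fmeasurable fmeasurableD) blast+
        then have "p + DIM('a) / R0 * measure lebesgue (F \<inter> (\<Union>k<n. B k)) \<le> p + DIM('a) / R0 * measure lebesgue (F - \<Omega>)"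
          using R0(1) by (intro add_left_mono mult_left_mono) auto
        then show ?thesis
          using perimeter_Diff_Union_balls_le[where B = B, OF F(1) R0(1) p B, of n]
          by (rule order_trans[OF _ ennreal_leI, rotated])
      qed
      \<comment> \<open>Frontier points are in no exterior ball and remain in every
        \<open>?A n\<close>; convergence holds off this null set.\<close>
      have "AE x in lebesgue. x \<notin> frontier \<Omega>"
        using assms(4) by (simp add: negligible_iff_null_sets AE_not_in)
      then show "AE x in lebesgue. (\<lambda>n. indicator (?A n) x :: real) \<longlonglongrightarrow> indicator (F \<inter> \<Omega>) x"
      proof eventually_elim
        case (elim x)
        show ?case
        proof (cases "x \<in> F - \<Omega>")
          case True
          with elim have "x \<notin> closure \<Omega>" using assms(1) by (simp add: frontier_def interior_open)
          then have "x \<in> \<Union>\<G>'" unfolding \<G>'(3) by (rule cover) (use F(2) True in blast)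
          then have "x \<in> \<Union>(range B)" unfolding rangeB by blast
          then obtain k where k: "x \<in> B k" by blast
          have "\<forall>\<^sub>F n in sequentially. indicator (?A n) x = (0::real)"
            using eventually_gt_at_top[of k] by eventually_elim (use k in \<open>auto simp: indicator_def\<close>)
          then show ?thesis using True by (simp add: tendsto_eventually)
        next
          case False
          then have "indicator (?A n) x = (indicator (F \<inter> \<Omega>) x :: real)" for n
            using B\<Omega> by (auto simp: indicator_def)
          then show ?thesis by simp
        qed
      qed
    qed
  qed
qed

subsection \<open>Contact set\<close>

text \<open>Each covering set that meets \<open>K\<close> is enlarged to an open ball centred in
  \<open>K\<close>, with radius slightly above its diameter; compactness then leaves finitely many.
  Centres in \<open>K\<close> make the volume estimate at frontier points applicable.\<close>

lemma hausdorff_measure_0_cover: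
  fixes K :: "'a::euclidean_space set"
  assumes K: "compact K" "hausdorff_measure m K = 0" and \<epsilon>: "0 < \<epsilon>" and \<rho>: "0 < \<rho>"
  obtains I :: "nat set" and q r where "finite I" "K \<subseteq> (\<Union>i\<in>I. ball (q i) (r i))"
    "\<And>i. i \<in> I \<Longrightarrow> q i \<in> K" "\<And>i. i \<in> I \<Longrightarrow> 0 < r i" "\<And>i. i \<in> I \<Longrightarrow> r i \<le> \<rho>"
    "(\<Sum>i\<in>I. r i ^ m) < \<epsilon>"
proof -
  define \<omega> where "\<omega> = unit_ball_vol (real m)"
  have \<omega>: "0 < \<omega>" by (simp add: \<omega>_def)
  \<comment> \<open>Chosen so that a Hausdorff sum below \<eta> means that the \<open>m\<close>-th
    powers of the diameters sum to less than \<open>\<epsilon> / 2\<close>.\<close>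
  define \<eta> where "\<eta> = \<omega> / 2 ^ m * (\<epsilon> / 2)"
  have \<eta>: "0 < \<eta>" using \<omega> \<epsilon> by (simp add: \<eta>_def)
  have "hausdorff_content m (\<rho> / 2) K \<le> hausdorff_measure m K"
    unfolding hausdorff_measure_def using \<rho> by (intro SUP_upper) auto
  then have "hausdorff_content m (\<rho> / 2) K < ennreal \<eta>"
    using K(2) \<eta> by (simp add: ennreal_zero_less_divide)
  then obtain U :: "nat \<Rightarrow> 'a set" where U: "K \<subseteq> (\<Union>i. U i)" "\<And>i. bounded (U i)" "\<And>i. diameter (U i) \<le> \<rho> / 2"
    and Ule: "(\<Sum>i. if U i = {} then 0 else ennreal (\<omega> * (diameter (U i) / 2) ^ m)) < ennreal \<eta>"
    unfolding hausdorff_content_def INF_less_iff \<omega>_def by blast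
  define J where "J = {i. U i \<inter> K \<noteq> {}}"
  have "\<forall>i\<in>J. \<exists>x. x \<in> U i \<inter> K" by (auto simp: J_def)
  from bchoice[OF this] obtain q where q: "\<And>i. i \<in> J \<Longrightarrow> q i \<in> U i \<inter> K" by blast
  let ?D = "\<lambda>i. diameter (U i)"
  \<comment> \<open>By continuity of the power, the radii can exceed the diameters, and so be
    positive, at a total cost of at most \<open>\<epsilon> / 2\<close>, distributed as a geometric
    series.\<close>
  have "\<forall>i. \<exists>s. ?D i < s \<and> s \<le> \<rho> \<and> s ^ m < ?D i ^ m + \<epsilon> / 2 * (1 / 2) ^ Suc i"
  proof
    fix i
    have "((\<lambda>s. s ^ m) \<longlongrightarrow> ?D i ^ m) (at_right (?D i))"
      by (intro tendsto_intros)
    then have "\<forall>\<^sub>F s in at_right (?D i). s ^ m < ?D i ^ m + \<epsilon> / 2 * (1 / 2) ^ Suc i"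
      by (rule order_tendstoD) (use \<epsilon> in simp)
    moreover have "\<forall>\<^sub>F s in at_right (?D i). s \<in> {?D i <..< \<rho>}"
      using U(3)[of i] \<rho> by (intro eventually_at_rightI[of _ \<rho>]) auto
    ultimately have "\<forall>\<^sub>F s in at_right (?D i). ?D i < s \<and> s \<le> \<rho> \<and> s ^ m < ?D i ^ m + \<epsilon> / 2 * (1 / 2) ^ Suc i"
      by eventually_elim auto
    then show "\<exists>s. ?D i < s \<and> s \<le> \<rho> \<and> s ^ m < ?D i ^ m + \<epsilon> / 2 * (1 / 2) ^ Suc i"
      by (rule eventually_happens'[rotated]) simp
  qed
  from choice[OF this] obtain r where r: "\<And>i. ?D i < r i" "\<And>i. r i \<le> \<rho>"
      "\<And>i. r i ^ m < ?D i ^ m + \<epsilon> / 2 * (1 / 2) ^ Suc i"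
    by blast
  have r0: "0 < r i" for i using r(1)[of i] diameter_ge_0[OF U(2)[of i]] by linarith
  have "K \<subseteq> (\<Union>i\<in>J. ball (q i) (r i))"
  proof
    fix x assume x: "x \<in> K"
    then obtain i where i: "x \<in> U i" using U(1) by blast
    then have "i \<in> J" using x by (auto simp: J_def)
    moreover have "dist (q i) x \<le> ?D i"
      using q[OF \<open>i \<in> J\<close>] i U(2) by (intro diameter_bounded_bound) auto
    ultimately show "x \<in> (\<Union>i\<in>J. ball (q i) (r i))" using r(1)[of i] by (intro UN_I[of i]) auto
  qed
  then obtain I where I: "I \<subseteq> J" "finite I" "K \<subseteq> (\<Union>i\<in>I. ball (q i) (r i))"
    by (rule compactE_image[OF K(1), of J "\<lambda>i. ball (q i) (r i)", rotated]) auto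
  have sum1: "(\<Sum>i\<in>I. ?D i ^ m) < \<epsilon> / 2"
  proof -
    have "ennreal (\<Sum>i\<in>I. \<omega> * (?D i / 2) ^ m) = (\<Sum>i\<in>I. ennreal (\<omega> * (?D i / 2) ^ m))"
      using \<omega> diameter_ge_0[OF U(2)] by (intro sum_ennreal[symmetric]) auto
    also have "\<dots> = (\<Sum>i\<in>I. if U i = {} then 0 else ennreal (\<omega> * (?D i / 2) ^ m))"
      using I(1) by (intro sum.cong) (auto simp: J_def)
    also have "\<dots> \<le> (\<Sum>i. if U i = {} then 0 else ennreal (\<omega> * (?D i / 2) ^ m))"
      using I(2) by (intro sum_le_suminf) auto
    also note Ule
    finally have "(\<Sum>i\<in>I. \<omega> * (?D i / 2) ^ m) < \<eta>"
      using \<omega> diameter_ge_0[OF U(2)] by (subst (asm) ennreal_less_iff) (auto intro!: sum_nonneg)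
    then have "\<omega> / 2 ^ m * (\<Sum>i\<in>I. ?D i ^ m) < \<omega> / 2 ^ m * (\<epsilon> / 2)"
      by (simp add: \<eta>_def power_divide sum_distrib_left)
    then show ?thesis using \<omega> by (subst (asm) mult_less_cancel_left_pos) auto
  qed
  have sum2: "(\<Sum>i\<in>I. (1 / 2 :: real) ^ Suc i) \<le> 1"
    using sum_le_suminf[OF sums_summable[OF power_half_series] I(2)] sums_unique[OF power_half_series]
    by (simp del: power_Suc)
  have "(\<Sum>i\<in>I. r i ^ m) \<le> (\<Sum>i\<in>I. ?D i ^ m + \<epsilon> / 2 * (1 / 2) ^ Suc i)"
    using r(3) by (intro sum_mono) (meson less_imp_le)
  also have "\<dots> = (\<Sum>i\<in>I. ?D i ^ m) + \<epsilon> / 2 * (\<Sum>i\<in>I. (1 / 2) ^ Suc i)"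
    by (simp only: sum.distrib sum_distrib_left)
  also have "\<dots> < \<epsilon> / 2 + \<epsilon> / 2 * 1"
    using sum1 sum2 \<epsilon> by (intro add_less_le_mono mult_left_mono) auto
  finally have "(\<Sum>i\<in>I. r i ^ m) < \<epsilon>" by simp
  then show thesis using that[OF I(2,3)] q I(1) r0 r(2) by blast
qed

text \<open>A cut-off radial field has divergence bounded below by a positive constant on
  \<open>E\<close>, so zero perimeter would force zero volume.\<close>

lemma perimeter_pos:
  fixes E :: "'a::euclidean_space set"
  assumes E: "E \<in> sets lebesgue" "bounded E" "0 < emeasure lebesgue E"
  shows "0 < perimeter E"
proof (rule ccontr)
  assume "\<not> 0 < perimeter E"
  then have P: "perimeter E \<le> ennreal 0" by simp
  obtain M where M: "0 < M" "\<And>x. x \<in> E \<Longrightarrow> norm x \<le> M"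
    using E(2) by (auto simp: bounded_pos)
  have El: "E \<in> lmeasurable" using E by (intro bounded_set_imp_lmeasurable)
  define R where "R = 3 * M"
  have R: "0 < R" using M by (simp add: R_def)
  \<comment> \<open>The form \<open>x - 0\<close> matches \<open>has_derivative_cutoff\<close> with
    centre 0.\<close>
  define w where "w = (\<lambda>x::'a. (1 / R) *\<^sub>R (x - 0))"
  define u where "u = (\<lambda>x. max 0 (1 - w x \<bullet> w x))"
  define V where "V = (\<lambda>x. (u x)\<^sup>2)"
  define V' where "V' = (\<lambda>x v. - (4 * u x / R) * (w x \<bullet> v))"
  define \<phi> where "\<phi> = (\<lambda>x. V x *\<^sub>R w x)"
  have Dw: "(w has_derivative (\<lambda>v. (1 / R) *\<^sub>R v)) (at x)" for x
    unfolding w_def by (auto intro!: derivative_eq_intros)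
  have DV: "(V has_derivative V' x) (at x)" for x
    using has_derivative_cutoff[of R 0 x] by (simp only: V_def V'_def u_def w_def)
  have D: "(\<phi> has_derivative (\<lambda>v. V x *\<^sub>R (1 / R) *\<^sub>R v + V' x v *\<^sub>R w x)) (at x)" for x
    unfolding \<phi>_def by (rule derivative_eq_intros Dw DV refl)+ 
  have contw: "continuous_on UNIV w" unfolding w_def by (intro continuous_intros)
  have contu: "continuous_on UNIV u" unfolding u_def by (intro continuous_intros contw)
  have contV: "continuous_on UNIV V" unfolding V_def by (intro continuous_intros contu)
  have cont: "continuous_on UNIV (\<lambda>x. V x *\<^sub>R (1 / R) *\<^sub>R v + V' x v *\<^sub>R w x)" for v
    unfolding V'_def using R by (intro continuous_intros contV contw contu) auto
  have supp: "norm (w x) < 1 \<or> V x = 0" for x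
  proof -
    have "(norm (w x))\<^sup>2 < 1 \<or> u x = 0" by (auto simp: u_def power2_norm_eq_inner)
    then show ?thesis by (auto simp: V_def abs_square_less_1)
  qed
  have \<phi>C1: "C1_compact_support \<phi>"
  proof (rule C1_compact_supportI[OF D cont bounded_ball])
    show "\<phi> x = 0" if "x \<notin> ball 0 R" for x
      using that supp[of x] R by (auto simp: \<phi>_def w_def)
  qed
  have "norm (\<phi> x) \<le> 1" for x
  proof (cases "V x = 0")
    case False
    have "0 \<le> u x" "u x \<le> 1" by (auto simp: u_def)
    then have "V x \<le> 1" "0 \<le> V x" by (auto simp: V_def power_le_one)
    then show ?thesis using supp[of x] False mult_mono[of "V x" 1 "norm (w x)" 1] by (simp add: \<phi>_def)
  qed (simp add: \<phi>_def)
  then have le: "(LINT x:E|lebesgue. divergence \<phi> x) \<le> 0"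
    using P \<phi>C1 unfolding perimeter_le_iff[OF order_refl] by blast
  \<comment> \<open>With \<open>R = 3 * M\<close>, \<open>norm (w x)\<close> is at most 1/3 on
    \<open>E\<close>. Hence \<open>u x\<close> is at least 8/9 and the bracket at least 8/9 - 4/9 in
    any dimension; the constant is their product over \<open>R\<close>.\<close>
  have div: "32 / (81 * R) \<le> divergence \<phi> x" if x: "x \<in> E" for x
  proof -
    have "norm (w x) \<le> 1 / 3" using M(2)[OF x] M(1) by (simp add: w_def R_def divide_simps)
    then have "(norm (w x))\<^sup>2 \<le> (1 / 3)\<^sup>2" by (rule power_mono) simp
    then have ww: "w x \<bullet> w x \<le> 1 / 9" by (simp add: power2_norm_eq_inner power_divide)
    then have u: "8 / 9 \<le> u x" by (simp add: u_def)
    have "divergence \<phi> x = (\<Sum>b\<in>Basis. V x / R * (b \<bullet> b) - 4 * u x / R * ((w x \<bullet> b) * (w x \<bullet> b)))"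
      by (subst divergence_eq[OF D]) (simp add: inner_add_left V'_def algebra_simps)
    also have "\<dots> = V x / R * DIM('a) - 4 * u x / R * (w x \<bullet> w x)"
      unfolding sum_subtractf sum_distrib_left[symmetric] by (simp flip: euclidean_inner)
    also have "\<dots> = u x / R * (u x * DIM('a) - 4 * (w x \<bullet> w x))"
      by (simp add: V_def power2_eq_square algebra_simps)
    finally have eq: "divergence \<phi> x = u x / R * (u x * DIM('a) - 4 * (w x \<bullet> w x))" .
    have "u x * 1 \<le> u x * DIM('a)" using u DIM_positive[where 'a='a] by (intro mult_left_mono) auto
    then have "4 / 9 \<le> u x * DIM('a) - 4 * (w x \<bullet> w x)" using u ww by linarith
    moreover have "8 / 9 / R \<le> u x / R" using u R by (intro divide_right_mono) auto
    ultimately have "8 / 9 / R * (4 / 9) \<le> u x / R * (u x * DIM('a) - 4 * (w x \<bullet> w x))"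
      using u R by (intro mult_mono) auto
    then show ?thesis unfolding eq by simp
  qed
  have "32 / (81 * R) * measure lebesgue E = (LINT x:E|lebesgue. 32 / (81 * R))"
    using El by (simp add: set_lebesgue_integral_def fmeasurable_def mult.commute)
  also have "\<dots> \<le> (LINT x:E|lebesgue. divergence \<phi> x)"
    using set_integrable_divergence[OF \<phi>C1 El] div
      set_integrable_bounded[OF El, of "\<lambda>_. 32 / (81 * R)" "\<bar>32 / (81 * R)\<bar>"]
    by (intro set_integral_mono) auto
  finally have "32 / (81 * R) * measure lebesgue E \<le> 0" using le by linarith
  moreover have "0 < measure lebesgue E"
    using El E(3) by (simp add: emeasure_eq_measure2)
  ultimately show False using R by (simp add: mult_le_0_iff divide_le_0_iff)
qed

text \<open>Minimality of the quotient, cross-multiplied so that competitors of measure 0 are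
  allowed as well.\<close>

lemma cheeger_set_minimal:
  fixes \<Omega> E G :: "'a::euclidean_space set"
  assumes E: "cheeger_set \<Omega> E" "E \<in> lmeasurable" "perimeter E = ennreal p" "0 \<le> p"
    and G: "G \<subseteq> \<Omega>" "G \<in> lmeasurable" "perimeter G \<le> ennreal P" "0 \<le> P"
  shows "p * measure lebesgue G \<le> P * measure lebesgue E"
proof (cases "measure lebesgue G = 0")
  case True
  then show ?thesis using G(4) by simp
next
  case False
  then have g: "0 < measure lebesgue G" by (simp add: zero_less_measure_iff)
  have eG: "emeasure lebesgue G = ennreal (measure lebesgue G)"
    and eE: "emeasure lebesgue E = ennreal (measure lebesgue E)"
    using E(2) G(2) by (simp_all add: emeasure_eq_measure2)
  have e: "0 < measure lebesgue E"
    using E(1) unfolding cheeger_set_def eE by simp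
  have "G \<in> {E. E \<subseteq> \<Omega> \<and> finite_perimeter E \<and> 0 < emeasure lebesgue E}"
  proof (intro CollectI conjI)
    show "finite_perimeter G"
      unfolding finite_perimeter_def using G(2,3) by (auto simp: fmeasurableD intro: le_less_trans)
    show "0 < emeasure lebesgue G" unfolding eG using g by simp
  qed (rule G(1))
  then have "cheeger_constant \<Omega> \<le> perimeter G / emeasure lebesgue G"
    unfolding cheeger_constant_def by (rule INF_lower)
  then have "ennreal p / ennreal (measure lebesgue E) \<le> perimeter G / ennreal (measure lebesgue G)"
    using E(1) unfolding cheeger_set_def E(3) eE eG by simp
  also have "\<dots> \<le> ennreal P / ennreal (measure lebesgue G)"
    using G(3) by (rule divide_right_mono_ennreal)
  finally have "p / measure lebesgue E \<le> P / measure lebesgue G"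
    using e g E(4) G(4) by (simp add: divide_ennreal)
  then show ?thesis using e g by (simp add: field_simps)
qed

text \<open>The cone at \<open>q\<close> contains balls disjoint from \<Omega> arbitrarily close to
  \<open>q\<close>. At a frontier point only the lower density condition of
  \<open>normalized_boundary\<close> thus remains to be checked.\<close>

lemma exterior_cone_emeasure_Int_ball_less:
  fixes \<Omega> :: "'a::euclidean_space set"
  assumes "open \<Omega>" "exterior_cone_at \<Omega> q" "q \<in> frontier \<Omega>" "E \<subseteq> \<Omega>" "0 < \<rho>"
  shows "emeasure lebesgue (E \<inter> ball q \<rho>) < emeasure lebesgue (ball q \<rho>)"
proof -
  obtain r \<kappa> \<nu> where r: "0 < r" and \<kappa>: "0 < \<kappa>" and \<nu>: "norm \<nu> = 1"
    and cone: "\<And>x s w. \<lbrakk>x \<in> ball q r; x \<notin> \<Omega>; 0 < s; s < r; norm w \<le> \<kappa> * s\<rbrakk> \<Longrightarrow> x + s *\<^sub>R \<nu> + w \<notin> \<Omega>"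
    using assms(2) unfolding exterior_cone_at_def by blast
  have q: "q \<in> ball q r" "q \<notin> \<Omega>" using r assms(1,3) by (auto simp: frontier_def interior_open)
  \<comment> \<open>For \<open>s \<le> a\<close> the ball of radius \<open>\<kappa> * s\<close>
    around \<open>q + s *\<^sub>R \<nu>\<close> stays inside \<open>ball q \<rho>\<close>.\<close>
  define a where "a = \<rho> / (1 + \<kappa>)"
  have "(1 + \<kappa>) * a = \<rho>" using \<kappa> by (simp add: a_def)
  then have a: "a + \<kappa> * a = \<rho>" by (simp add: distrib_right)
  have a0: "0 < a" using assms(5) \<kappa> by (simp add: a_def)
  define s where "s = min r a / 2"
  have s: "0 < s" "s < r" "s \<le> a" using r a0 by (auto simp: s_def min_def)
  have "s + \<kappa> * s \<le> \<rho>"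
    using s(3) mult_left_mono[OF s(3), of \<kappa>] \<kappa> a by linarith
  note s = s(1,2) this
  let ?B = "ball (q + s *\<^sub>R \<nu>) (\<kappa> * s)"
  have disj: "?B \<inter> \<Omega> = {}"
  proof -
    have "z \<notin> \<Omega>" if "z \<in> ?B" for z
      using cone[OF q s(1,2), of "z - (q + s *\<^sub>R \<nu>)"] that by (simp add: dist_norm norm_minus_commute)
    then show ?thesis by blast
  qed
  have sub: "?B \<subseteq> ball q \<rho>"
    using s \<nu> by (simp add: ball_subset_ball_iff dist_norm)
  have "measure lebesgue (ball q \<rho> - ?B) = measure lebesgue (ball q \<rho>) - measure lebesgue ?B"
    using sub by (intro measurable_measure_Diff) auto
  moreover have "0 < measure lebesgue ?B"
    using content_ball_pos[of "\<kappa> * s" "q + s *\<^sub>R \<nu>"] s \<kappa> by (simp add: measure_completion)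
  ultimately have less: "measure lebesgue (ball q \<rho> - ?B) < measure lebesgue (ball q \<rho>)" by simp
  have "emeasure lebesgue (E \<inter> ball q \<rho>) \<le> emeasure lebesgue (ball q \<rho> - ?B)"
    using assms(4) disj by (intro emeasure_mono) auto
  also have "\<dots> = ennreal (measure lebesgue (ball q \<rho> - ?B))"
    by (intro emeasure_eq_measure2 fmeasurable_Diff) auto
  also have "\<dots> < ennreal (measure lebesgue (ball q \<rho>))"
    using less assms(5) by (intro ennreal_lessI) auto
  also have "\<dots> = emeasure lebesgue (ball q \<rho>)"
    by (intro emeasure_eq_measure2[symmetric]) auto
  finally show ?thesis .
qed

text \<open>If \<open>E\<close> is null or of full measure in \<open>ball x r\<close>, it is so in
  the ball of half the radius around every point near \<open>x\<close>.\<close>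

lemma closed_normalized_boundary:
  fixes E :: "'a::euclidean_space set"
  assumes "E \<in> sets lebesgue"
  shows "closed (normalized_boundary E)"
  unfolding closed_def open_contains_ball
proof
  fix x assume "x \<in> - normalized_boundary E"
  then obtain r where r: "0 < r" and x: "emeasure lebesgue (E \<inter> ball x r) = 0 \<or>
      emeasure lebesgue (ball x r) \<le> emeasure lebesgue (E \<inter> ball x r)"
    by (auto simp: normalized_boundary_def not_less simp del: emeasure_completion)
  have "y \<notin> normalized_boundary E" if y: "y \<in> ball x (r / 2)" for y
  proof -
    have sub: "ball y (r / 2) \<subseteq> ball x r"
      using y r by (auto simp: ball_subset_ball_iff dist_commute)
    have meas: "E \<inter> ball z s \<in> sets lebesgue" "ball z s - E \<in> sets lebesgue" for z s
      using assms by auto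
    from x have "emeasure lebesgue (E \<inter> ball y (r / 2)) = 0 \<or>
        emeasure lebesgue (ball y (r / 2)) \<le> emeasure lebesgue (E \<inter> ball y (r / 2))"
    proof
      assume "emeasure lebesgue (E \<inter> ball x r) = 0"
      moreover have "emeasure lebesgue (E \<inter> ball y (r / 2)) \<le> emeasure lebesgue (E \<inter> ball x r)"
        using sub meas by (intro emeasure_mono) auto
      ultimately show ?thesis by simp
    next
      assume *: "emeasure lebesgue (ball x r) \<le> emeasure lebesgue (E \<inter> ball x r)"
      have "emeasure lebesgue (ball x r - E \<inter> ball x r)
          = emeasure lebesgue (ball x r) - emeasure lebesgue (E \<inter> ball x r)"
      proof (rule emeasure_Diff)
        show "emeasure lebesgue (E \<inter> ball x r) \<noteq> \<infinity>"
          using fmeasurableD2[OF fmeasurable_Int_fmeasurable[OF lmeasurable_ball assms], of x r]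
          by (simp add: Int_commute del: emeasure_completion)
      qed (use meas in auto)
      also have "\<dots> = 0" using * fmeasurableD2[OF lmeasurable_ball, of x r]
        by (simp add: diff_eq_0_iff_ennreal less_top del: emeasure_completion)
      finally have 0: "emeasure lebesgue (ball x r - E) = 0" by (simp add: Diff_Int2 Diff_Int del: emeasure_completion)
      have "emeasure lebesgue (ball y (r / 2)) \<le> emeasure lebesgue ((E \<inter> ball y (r / 2)) \<union> (ball x r - E))"
        using sub meas by (intro emeasure_mono sets.Un) blast+
      also have "\<dots> \<le> emeasure lebesgue (E \<inter> ball y (r / 2)) + emeasure lebesgue (ball x r - E)"
        using meas by (intro emeasure_subadditive)
      finally show ?thesis using 0 by simp
    qed
    then show ?thesis
      using r unfolding normalized_boundary_def mem_Collect_eq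
      by (metis half_gt_zero less_irrefl not_less)
  qed
  then show "\<exists>e>0. ball x e \<subseteq> - normalized_boundary E"
    using r by (intro exI[of _ "r / 2"]) auto
qed

text \<open>All balls in which \<open>E\<close> is null are removed; by Lindelof the loss is a null
  set. Otherwise stray null parts of \<open>E\<close> could approach the frontier away from the
  normalized boundary.\<close>

lemma lebesgue_support:
  fixes E :: "'a::euclidean_space set"
  assumes "E \<in> sets lebesgue"
  obtains E' where "E' \<subseteq> E" "E' \<in> sets lebesgue" "negligible (E - E')"
    "\<And>x r. \<lbrakk>x \<in> closure E'; 0 < r\<rbrakk> \<Longrightarrow> 0 < emeasure lebesgue (E \<inter> ball x r)"
proof -
  define \<G> where "\<G> = {ball x r |x r. negligible (E \<inter> ball x r)}"
  obtain \<G>' where \<G>': "\<G>' \<subseteq> \<G>" "countable \<G>'" "\<Union>\<G>' = \<Union>\<G>"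
    by (rule Lindelof[of \<G>]) (auto simp: \<G>_def)
  have op: "open (\<Union>\<G>)" by (auto simp: \<G>_def)
  have "negligible (\<Union>B\<in>\<G>'. E \<inter> B)"
    using \<G>'(1,2) by (intro negligible_countable_Union) (auto simp: \<G>_def)
  moreover have "E - (E - \<Union>\<G>) = (\<Union>B\<in>\<G>'. E \<inter> B)"
    unfolding \<G>'(3)[symmetric] by blast
  ultimately have neg: "negligible (E - (E - \<Union>\<G>))" by simp
  show thesis
  proof (rule that[OF _ _ neg])
    show "E - \<Union>\<G> \<in> sets lebesgue" using assms op by (intro sets.Diff) auto
    show "0 < emeasure lebesgue (E \<inter> ball x r)" if x: "x \<in> closure (E - \<Union>\<G>)" and r: "0 < r" for x r
    proof (rule ccontr)
      assume "\<not> 0 < emeasure lebesgue (E \<inter> ball x r)"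
      then have "E \<inter> ball x r \<in> null_sets lebesgue" using assms by (auto intro!: null_setsI)
      then have "ball x r \<in> \<G>" unfolding \<G>_def negligible_iff_null_sets by blast
      then have "x \<in> \<Union>\<G>" using r by (intro UnionI[of "ball x r"]) auto
      moreover have "closure (E - \<Union>\<G>) \<subseteq> - \<Union>\<G>"
        using op by (intro closure_minimal) auto
      ultimately show False using x by blast
    qed
  qed blast
qed

text \<open>Since \<open>P (t E) = t\<^sup>d\<^sup>-\<^sup>1 P E\<close> while \<open>|t E| = t\<^sup>d |E|\<close>, dilating \<open>E\<close> decreases \<open>P - h |\<cdot>|\<close> at a linear
  rate in \<open>t - 1\<close>; minimality forces a comparable volume of \<open>t E\<close> to leave \<open>\<Omega>\<close>.\<close>

lemma dilation_escapes:
  fixes \<Omega> E E' :: "'a::euclidean_space set"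
  assumes E: "cheeger_set \<Omega> E" "E \<in> lmeasurable" "perimeter E = ennreal p" "0 \<le> p"
    and E': "E' \<in> lmeasurable" "measure lebesgue E' = measure lebesgue E" "perimeter E' \<le> ennreal p"
    and \<Omega>: "open \<Omega>" and t: "1 \<le> t" and c: "0 \<le> c"
    and cut: "\<And>P. perimeter ((*\<^sub>R) t ` E') \<le> ennreal P \<Longrightarrow> 0 \<le> P \<Longrightarrow>
      perimeter ((*\<^sub>R) t ` E' \<inter> \<Omega>) \<le> ennreal (P + c * measure lebesgue ((*\<^sub>R) t ` E' - \<Omega>))"
  shows "p * measure lebesgue E * (t - 1)
     \<le> (p + c * measure lebesgue E) * measure lebesgue ((*\<^sub>R) t ` E' - \<Omega>)"
proof -
  let ?d = "DIM('a)" and ?F = "(*\<^sub>R) t ` E'"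
  define m where "m = measure lebesgue E"
  define \<mu> where "\<mu> = measure lebesgue (?F - \<Omega>)"
  have m: "0 \<le> m" by (simp add: m_def)
  have F: "?F \<in> lmeasurable" using E'(1) by (rule lmeasurable_scaleR)
  have FO: "?F \<inter> \<Omega> \<in> lmeasurable" "?F - \<Omega> \<in> lmeasurable"
    using fmeasurable_Diff[OF F, of \<Omega>] fmeasurable_Int_fmeasurable[OF F, of \<Omega>] \<Omega> by simp_all
  have "measure lebesgue ?F = t ^ ?d * m"
    using measure_lebesgue_affine[of t 0 E'] t E'(2) by (simp add: m_def)
  moreover have "measure lebesgue ?F = measure lebesgue (?F \<inter> \<Omega>) + \<mu>"
  proof -
    have "?F = (?F \<inter> \<Omega>) \<union> (?F - \<Omega>)" "(?F \<inter> \<Omega>) \<inter> (?F - \<Omega>) = {}" by blast+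
    then show ?thesis unfolding \<mu>_def using measure_Un3[OF FO] by simp
  qed
  ultimately have vol: "measure lebesgue (?F \<inter> \<Omega>) = t ^ ?d * m - \<mu>" by linarith
  have "perimeter ?F \<le> ennreal (t ^ (?d - 1) * p)"
    using E' E(4) t by (intro perimeter_scaleR_le) (auto dest: fmeasurableD)
  then have "perimeter (?F \<inter> \<Omega>) \<le> ennreal (t ^ (?d - 1) * p + c * \<mu>)"
    unfolding \<mu>_def using E(4) t by (intro cut) auto
  then have "p * measure lebesgue (?F \<inter> \<Omega>) \<le> (t ^ (?d - 1) * p + c * \<mu>) * measure lebesgue E"
    using FO(1) E(4) t c by (intro cheeger_set_minimal[OF E]) (auto simp: \<mu>_def)
  then have "p * (t ^ ?d * m - \<mu>) \<le> (t ^ (?d - 1) * p + c * \<mu>) * m"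
    unfolding vol m_def[symmetric] .
  moreover have "t ^ ?d = t * t ^ (?d - 1)" by (subst power_eq_if) simp
  ultimately have "(p * m * (t - 1)) * t ^ (?d - 1) \<le> (p + c * m) * \<mu>"
    by (simp add: algebra_simps)
  moreover have "(p * m * (t - 1)) * 1 \<le> (p * m * (t - 1)) * t ^ (?d - 1)"
    using t E(4) m by (intro mult_left_mono) auto
  ultimately show ?thesis unfolding m_def \<mu>_def by linarith
qed

text \<open>Both kinds of domains enter only through exterior balls and cones, so one argument by
  contradiction serves both.\<close>

lemma cheeger_set_contact_pos:
  fixes \<Omega> E :: "'a::euclidean_space set"
  assumes \<Omega>: "open \<Omega>" "bounded \<Omega>" and E: "cheeger_set \<Omega> E"
    and eb: "\<And>p. p \<in> frontier \<Omega> \<Longrightarrow> exterior_ball_at \<Omega> p"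
    and ec: "\<And>p. p \<in> frontier \<Omega> \<Longrightarrow> exterior_cone_at \<Omega> p"
  shows "0 < hausdorff_measure (DIM('a) - 1) (normalized_boundary E \<inter> frontier \<Omega>)"
proof (rule ccontr)
  let ?K = "normalized_boundary E \<inter> frontier \<Omega>" and ?d = "DIM('a)"
  assume "\<not> 0 < hausdorff_measure (?d - 1) ?K"
  then have H0: "hausdorff_measure (?d - 1) ?K = 0" by simp
  have E\<Omega>: "E \<subseteq> \<Omega>" and Es: "E \<in> sets lebesgue" and Efin: "perimeter E < \<infinity>" and Epos: "0 < emeasure lebesgue E"
    using E by (auto simp: cheeger_set_def finite_perimeter_def)
  have \<Omega>ne: "\<Omega> \<noteq> {}" using E\<Omega> Epos by auto
  have Eb: "bounded E" using \<Omega>(2) E\<Omega> bounded_subset by blast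
  have El: "E \<in> lmeasurable" using Eb Es by (rule bounded_set_imp_lmeasurable)
  define p where "p = enn2real (perimeter E)"
  have p: "perimeter E = ennreal p" using Efin by (simp add: p_def)
  have p0: "0 < p" using perimeter_pos[OF Es Eb Epos] p by simp
  define m where "m = measure lebesgue E"
  have m0: "0 < m" using Epos El by (simp add: m_def emeasure_eq_measure2)
  obtain M where M: "0 < M" "\<And>x. x \<in> \<Omega> \<Longrightarrow> norm x \<le> M"
    using \<Omega>(2) by (auto simp: bounded_pos)
  have neg: "negligible (frontier \<Omega>)"
    using \<Omega> \<Omega>ne ec by (intro exterior_cone_negligible_frontier) auto
  obtain \<delta> R where \<delta>: "0 < \<delta>" and R: "0 < R"
    and cut: "\<And>F p. \<lbrakk>F \<in> lmeasurable; \<And>x. x \<in> F \<Longrightarrow> infdist x \<Omega> < \<delta>; perimeter F \<le> ennreal p; 0 \<le> p\<rbrakk> \<Longrightarrow>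
       perimeter (F \<inter> \<Omega>) \<le> ennreal (p + ?d / R * measure lebesgue (F - \<Omega>))"
    using perimeter_Int_le[OF \<Omega> \<Omega>ne neg eb] by metis
  obtain \<rho>\<^sub>0 C c where C: "0 < \<rho>\<^sub>0" "0 < C" "0 < c"
    and vol: "\<And>q \<rho> \<tau>. \<lbrakk>q \<in> frontier \<Omega>; 0 < \<rho>; \<rho> \<le> \<rho>\<^sub>0; 0 < \<tau>; \<tau> \<le> c * \<rho>\<rbrakk> \<Longrightarrow>
       measure lebesgue (outer_layer \<Omega> \<tau> \<inter> ball q \<rho>) \<le> C * \<rho> ^ (?d - 1) * \<tau>"
    using outer_layer_volume[OF \<Omega>(1) \<Omega>ne \<Omega>(2) ec] by metis
  have Kcomp: "compact ?K"
    using closed_normalized_boundary[OF Es] \<Omega>(2) by (intro closed_Int_compact) (simp_all add: compact_frontier_bounded)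
  \<comment> \<open>The factor from \<open>dilation_escapes\<close> times the constant in the bound
    for the escaping volume; covering sums below \<open>p * m / A\<close> are too small for the two
    estimates to be compatible.\<close>
  define A where "A = (p + ?d / R * m) * (C * 2 ^ (?d - 1) * M)"
  have A0: "0 < A" using p0 R m0 C M by (simp add: A_def add_pos_nonneg)
  \<comment> \<open>Radii are at most half of \<open>\<rho>\<^sub>0\<close> because the volume
    estimate is applied to the doubled balls.\<close>
  obtain I :: "nat set" and q r where I: "finite I" "?K \<subseteq> (\<Union>i\<in>I. ball (q i) (r i))"
    and q: "\<And>i. i \<in> I \<Longrightarrow> q i \<in> ?K" and r: "\<And>i. i \<in> I \<Longrightarrow> 0 < r i" "\<And>i. i \<in> I \<Longrightarrow> r i \<le> \<rho>\<^sub>0 / 2"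
    and rsum: "(\<Sum>i\<in>I. r i ^ (?d - 1)) < p * m / A"
    by (rule hausdorff_measure_0_cover[OF Kcomp H0, of "p * m / A" "\<rho>\<^sub>0 / 2"])
      (use p0 m0 A0 C in auto)
  let ?V = "\<Union>i\<in>I. ball (q i) (r i)"
  obtain E' where E': "E' \<subseteq> E" "E' \<in> sets lebesgue" "negligible (E - E')"
    and supp: "\<And>x r. \<lbrakk>x \<in> closure E'; 0 < r\<rbrakk> \<Longrightarrow> 0 < emeasure lebesgue (E \<inter> ball x r)"
    using lebesgue_support[OF Es] by metis
  have E'l: "E' \<in> lmeasurable" using El E'(1,2) by (metis fmeasurableI2)
  have E'm: "measure lebesgue E' = measure lebesgue E"
    using E'(1,3) by (intro measure_negligible_symdiff[OF El]) (simp add: Un_absorb2)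
  have E'p: "perimeter E' \<le> ennreal p"
  proof (rule perimeter_lower_semicontinuous[OF El, of "\<lambda>_. E"])
    have "AE x in lebesgue. x \<notin> E - E'"
      using E'(3) unfolding negligible_iff_null_sets by (rule AE_not_in)
    then show "AE x in lebesgue. (\<lambda>n::nat. indicator E x :: real) \<longlonglongrightarrow> indicator E' x"
      by eventually_elim (use E'(1) in \<open>auto simp: indicator_def\<close>)
  qed (use Es E'(2) p p0 in auto)
  let ?S = "closure E' - ?V"
  have "bounded (closure E')" using Eb E'(1) by (meson bounded_closure bounded_subset)
  then have Scomp: "compact ?S"
    by (intro compact_diff) (auto simp: compact_eq_bounded_closed)
  \<comment> \<open>A frontier point in \<open>closure E'\<close> satisfies both density conditions,
    hence is a contact point and lies in one of the removed balls.\<close>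
  have S\<Omega>: "?S \<subseteq> \<Omega>"
  proof
    fix x assume x: "x \<in> ?S"
    have "x \<notin> frontier \<Omega>"
    proof
      assume fr: "x \<in> frontier \<Omega>"
      then have "x \<in> ?K"
        using x supp exterior_cone_emeasure_Int_ball_less[OF \<Omega>(1) ec[OF fr] fr E\<Omega>]
        by (auto simp: normalized_boundary_def)
      then show False using I(2) x by blast
    qed
    moreover have "x \<in> closure \<Omega>" using x E'(1) E\<Omega> closure_mono[of E' \<Omega>] by blast
    ultimately show "x \<in> \<Omega>" using \<Omega>(1) by (simp add: frontier_def interior_open)
  qed
  obtain \<tau>\<^sub>0 where \<tau>\<^sub>0: "0 < \<tau>\<^sub>0" "\<And>x. x \<in> ?S \<Longrightarrow> ball x \<tau>\<^sub>0 \<subseteq> \<Omega>"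
    by (rule Heine_Borel_lemma[OF Scomp, of "{\<Omega>}"]) (use S\<Omega> \<Omega>(1) in auto)
  \<comment> \<open>The bounds ensure in turn that points of \<open>?S\<close> moved by \<tau> stay
    in \<Omega>, that \<open>cut\<close> applies, that points of the covering balls stay in the
    doubled ones, and that the layer is thin enough for \<open>vol\<close>.\<close>
  define \<tau> where "\<tau> = Min (insert (\<tau>\<^sub>0 / 2) (insert (\<delta> / 2) ((\<lambda>i. min (r i) (c * (2 * r i))) ` I)))"
  have \<tau>: "0 < \<tau>" "\<tau> < \<tau>\<^sub>0" "\<tau> < \<delta>" "\<And>i. i \<in> I \<Longrightarrow> \<tau> \<le> r i" "\<And>i. i \<in> I \<Longrightarrow> \<tau> \<le> c * (2 * r i)"
  proof -
    show "0 < \<tau>" using I(1) r(1) \<tau>\<^sub>0(1) \<delta> C(3) by (simp add: \<tau>_def)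
    have "\<tau> \<le> \<tau>\<^sub>0 / 2" "\<tau> \<le> \<delta> / 2" unfolding \<tau>_def using I(1) by (intro Min_le; simp)+
    then show "\<tau> < \<tau>\<^sub>0" "\<tau> < \<delta>" using \<tau>\<^sub>0(1) \<delta> by linarith+
    have "\<tau> \<le> min (r i) (c * (2 * r i))" if "i \<in> I" for i
      unfolding \<tau>_def using I(1) that by (intro Min_le) auto
    then show "\<And>i. i \<in> I \<Longrightarrow> \<tau> \<le> r i" "\<And>i. i \<in> I \<Longrightarrow> \<tau> \<le> c * (2 * r i)" by auto
  qed
  \<comment> \<open>As \<Omega> lies in the ball of radius \<open>M\<close> around 0, this dilation
    moves its points by at most \<tau>.\<close>
  define t where "t = 1 + \<tau> / M"
  have t: "1 < t" "(t - 1) * M = \<tau>" using \<tau>(1) M(1) by (simp_all add: t_def)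
  let ?F = "(*\<^sub>R) t ` E'"
  have near: "\<exists>y\<in>E'. dist x y \<le> \<tau>" if x: "x \<in> ?F" for x
  proof -
    obtain y where y: "y \<in> E'" "x = t *\<^sub>R y" using x by blast
    have "x - y = (t - 1) *\<^sub>R y" by (simp add: y(2) algebra_simps)
    then have "dist x y = (t - 1) * norm y" using t(1) by (simp add: dist_norm)
    also have "\<dots> \<le> (t - 1) * M" using t(1) M(2) y(1) E'(1) E\<Omega> by (intro mult_left_mono) auto
    finally show ?thesis using y(1) t(2) by auto
  qed
  have infd: "infdist x \<Omega> \<le> \<tau>" if x: "x \<in> ?F" for x
    using near[OF x] E'(1) E\<Omega> by (meson infdist_le2 subsetD)
  have F: "?F \<in> lmeasurable" using E'l by (rule lmeasurable_scaleR)
  have "p * measure lebesgue E * (t - 1)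
     \<le> (p + ?d / R * measure lebesgue E) * measure lebesgue (?F - \<Omega>)"
  proof (rule dilation_escapes[OF E El p _ E'l E'm E'p \<Omega>(1)])
    show "perimeter (?F \<inter> \<Omega>) \<le> ennreal (P + ?d / R * measure lebesgue (?F - \<Omega>))"
      if "perimeter ?F \<le> ennreal P" "0 \<le> P" for P
      using F _ that by (rule cut) (use infd \<tau>(3) in fastforce)
  qed (use p0 t R in auto)
  moreover have "measure lebesgue (?F - \<Omega>) \<le> (C * 2 ^ (?d - 1) * M) * (\<Sum>i\<in>I. r i ^ (?d - 1)) * (t - 1)"
  proof -
    \<comment> \<open>A point that has left \<Omega> comes from some \<open>y\<close> within \<tau>,
      which cannot lie in \<open>?S\<close>. So \<open>y\<close> is in a covering ball, and the
      point itself in the doubled one.\<close>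
    have sub: "?F - \<Omega> \<subseteq> (\<Union>i\<in>I. outer_layer \<Omega> \<tau> \<inter> ball (q i) (2 * r i))"
    proof
      fix x assume x: "x \<in> ?F - \<Omega>"
      then obtain y where y: "y \<in> E'" "dist x y \<le> \<tau>" using near by blast
      have "x \<in> ball y \<tau>\<^sub>0" using y(2) \<tau>(2) by (simp add: dist_commute)
      then have "y \<notin> ?S" using \<tau>\<^sub>0(2) x by blast
      moreover have "y \<in> closure E'" using y(1) closure_subset by blast
      ultimately obtain i where i: "i \<in> I" "y \<in> ball (q i) (r i)" by blast
      have "dist (q i) x < 2 * r i"
        using i(2) y(2) \<tau>(4)[OF i(1)] dist_triangle2[of "q i" x y] by simp
      then show "x \<in> (\<Union>i\<in>I. outer_layer \<Omega> \<tau> \<inter> ball (q i) (2 * r i))"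
        using i(1) x infd by (auto simp: outer_layer_def)
    qed
    have layer: "outer_layer \<Omega> \<tau> \<inter> ball (q i) (2 * r i) \<in> lmeasurable" for i
      using \<Omega>(1) by (rule outer_layer_Int_ball_lmeasurable)
    have "measure lebesgue (?F - \<Omega>) \<le> measure lebesgue (\<Union>i\<in>I. outer_layer \<Omega> \<tau> \<inter> ball (q i) (2 * r i))"
      using sub fmeasurable_Diff[OF F, of \<Omega>] \<Omega>(1) layer I(1)
      by (intro measure_mono_fmeasurable fmeasurableD fmeasurable.finite_UN) auto
    also have "\<dots> \<le> (\<Sum>i\<in>I. measure lebesgue (outer_layer \<Omega> \<tau> \<inter> ball (q i) (2 * r i)))"
      using I(1) layer by (intro measure_UNION_le) (auto dest: fmeasurableD)
    also have "\<dots> \<le> (\<Sum>i\<in>I. C * (2 * r i) ^ (?d - 1) * \<tau>)"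
      using q r \<tau>(1,5) by (intro sum_mono vol) (auto simp: field_simps)
    also have "\<dots> = (C * 2 ^ (?d - 1) * M) * (\<Sum>i\<in>I. r i ^ (?d - 1)) * (t - 1)"
      unfolding t(2)[symmetric] by (simp add: power_mult_distrib sum_distrib_left sum_distrib_right mult_ac)
    finally show ?thesis .
  qed
  ultimately have "p * m * (t - 1) \<le> (p + ?d / R * m) * ((C * 2 ^ (?d - 1) * M) * (\<Sum>i\<in>I. r i ^ (?d - 1)) * (t - 1))"
    unfolding m_def[symmetric] using p0 R m0
    by (elim order_trans) (intro mult_left_mono, auto)
  also have "\<dots> = A * (\<Sum>i\<in>I. r i ^ (?d - 1)) * (t - 1)" by (simp add: A_def mult_ac)
  also have "\<dots> < A * (p * m / A) * (t - 1)"
    using rsum A0 t(1) by (intro mult_strict_right_mono mult_strict_left_mono) auto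
  also have "\<dots> = p * m * (t - 1)" using A0 by simp
  finally show False by simp
qed

theorem corollary3p1:
  fixes \<Omega> E :: "(real ^ 'n) set"
  assumes "CARD('n) \<ge> 2"
    and "open \<Omega>" and "bounded \<Omega>"
    and "C11_boundary \<Omega> \<or> convex \<Omega>"
    and "cheeger_set \<Omega> E"
  shows "hausdorff_measure (CARD('n) - 1) (normalized_boundary E \<inter> frontier \<Omega>) > 0"
proof -
  \<comment> \<open>The convex lemmas need a point of \<Omega>; the positive measure of
    \<open>E\<close> provides one.\<close>
  have ne: "\<Omega> \<noteq> {}" using assms(5) by (auto simp: cheeger_set_def)
  have "exterior_ball_at \<Omega> p" "exterior_cone_at \<Omega> p" if "p \<in> frontier \<Omega>" for p
    using assms(4) that C11_boundary_exterior_ball_cone_at convex_exterior_ball_at[OF _ ne]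
      convex_exterior_cone_at[OF assms(2) _ ne] by blast+
  then show ?thesis using cheeger_set_contact_pos[OF assms(2,3,5)] by simp
qed

end
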